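(* Let $\{A,T',U',R,Q\}$ be a data set for the relaxed commutant lifting problem (see context). Then there exists a unique contractive interpolant for $\{A,T',U',R,Q\}$ if and only if the underlying contraction $\omega=\begin{pmatrix}\omega_1\\ \omega_2\end{pmatrix}$ satisfies one of the following conditions: (i) $\overline{\mathcal{D}_A Q\mathcal{H}_0}=\mathcal{D}_A$; (ii) the operator $\omega_1(\Pi_{\mathcal{F}}\omega_2)^n:\mathcal{F}\to\mathcal{D}_{T'}$ is a co-isometry for every $n=0,1,2,\ldots$.
   Context: For a contraction $N$, $D_N=(I-N^*N)^{1/2}$ is its defect operator and $\mathcal{D}_N=\overline{D_N(\text{domain})}$ its defect space. For a subspace $\mathcal{V}$ of a Hilbert space $\mathcal{W}$, $\Pi_{\mathcal{V}}$ denotes the orthogonal projection of $\mathcal{W}$ onto $\mathcal{V}$, viewed as an operator from $\mathcal{W}$ onto $\mathcal{V}$. A data set $\{A,T',U',R,Q\}$ consists of: a contraction $A:\mathcal{H}\to\mathcal{H}'$; a contraction $T'$ on $\mathcal{H}'$; a minimal isometric lifting $U'$ of $T'$, i.e. an isometry $U'$ on a Hilbert space $\mathcal{K}'\supseteq\mathcal{H}'$ such that $\mathcal{H}'$ is cyclic for $U'$ and $\Pi_{\mathcal{H}'}U'=T'\Pi_{\mathcal{H}'}$; and operators $R,Q:\mathcal{H}_0\to\mathcal{H}$ with $T'AR=AQ$ and $R^*R\le Q^*Q$. A contractive interpolant for the data set is a contraction $B:\mathcal{H}\to\mathcal{K}'$ with $\Pi_{\mathcal{H}'}B=A$ and $U'BR=BQ$.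 The underlying contraction is the (well-defined) contraction $\omega:\mathcal{F}=\overline{D_AQ\mathcal{H}_0}\to\mathcal{D}_{T'}\oplus\mathcal{D}_A$ determined by $\omega D_AQ=\begin{pmatrix}D_{T'}AR\\ D_AR\end{pmatrix}$; $\omega_1:\mathcal{F}\to\mathcal{D}_{T'}$ and $\omega_2:\mathcal{F}\to\mathcal{D}_A$ are its components, and $\Pi_{\mathcal{F}}$ is the projection of $\mathcal{D}_A$ onto $\mathcal{F}$. *)

theory Defs
  imports "HOL-Analysis.Analysis"
begin

class complex_vector = real_vector +
  fixes scaleC :: "complex \<Rightarrow> 'a \<Rightarrow> 'a"
  assumes scaleC_add_right: "scaleC a (x + y) = scaleC a x + scaleC a y"
    and scaleC_add_left: "scaleC (a + b) x = scaleC a x + scaleC b x"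
    and scaleC_scaleC: "scaleC a (scaleC b x) = scaleC (a * b) x"
    and scaleC_one: "scaleC 1 x = x"
    and scaleR_scaleC: "scaleR r x = scaleC (complex_of_real r) x"

class complex_inner = complex_vector + real_normed_vector +
  fixes cinner :: "'a \<Rightarrow> 'a \<Rightarrow> complex"
  assumes cinner_commute: "cinner x y = cnj (cinner y x)"
    and cinner_add_left: "cinner (x + y) z = cinner x z + cinner y z"
    and cinner_scaleC_left: "cinner (scaleC a x) y = cnj a * cinner x y"
    and cinner_ge_zero: "0 \<le> Re (cinner x x)"
    and cinner_eq_zero_iff: "cinner x x = 0 \<longleftrightarrow> x = 0"
    and norm_eq_sqrt_cinner: "norm x = sqrt (Re (cinner x x))"

class chilbert = complex_inner + complete_space

definition clinear :: "('a::complex_vector \<Rightarrow> 'b::complex_vector) \<Rightarrow> bool" where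
  "clinear f \<longleftrightarrow> (\<forall>x y. f (x + y) = f x + f y) \<and> (\<forall>a x. f (scaleC a x) = scaleC a (f x))"

definition bop :: "('a::complex_inner \<Rightarrow> 'b::complex_inner) \<Rightarrow> bool" where
  "bop f \<longleftrightarrow> clinear f \<and> (\<exists>K. \<forall>x. norm (f x) \<le> K * norm x)"

definition contraction :: "('a::complex_inner \<Rightarrow> 'b::complex_inner) \<Rightarrow> bool" where
  "contraction f \<longleftrightarrow> clinear f \<and> (\<forall>x. norm (f x) \<le> norm x)"

definition isometry :: "('a::complex_inner \<Rightarrow> 'b::complex_inner) \<Rightarrow> bool" where
  "isometry f \<longleftrightarrow> clinear f \<and> (\<forall>x. norm (f x) = norm x)"

definition adj :: "('a::complex_inner \<Rightarrow> 'b::complex_inner) \<Rightarrow> 'b \<Rightarrow> 'a" where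
  "adj f = (THE g. \<forall>x y. cinner (f x) y = cinner x (g y))"

definition positive_op :: "('a::complex_inner \<Rightarrow> 'a) \<Rightarrow> bool" where
  "positive_op S \<longleftrightarrow> (\<forall>x. cinner (S x) x = complex_of_real (Re (cinner (S x) x))
                          \<and> 0 \<le> Re (cinner (S x) x))"

definition op_sqrt :: "('a::complex_inner \<Rightarrow> 'a) \<Rightarrow> 'a \<Rightarrow> 'a" where
  "op_sqrt P = (THE S. bop S \<and> positive_op S \<and> (\<forall>x. S (S x) = P x))"

definition defect :: "('a::complex_inner \<Rightarrow> 'b::complex_inner) \<Rightarrow> 'a \<Rightarrow> 'a" where
  "defect N = op_sqrt (\<lambda>x. x - adj N (N x))"

definition defect_space :: "('a::complex_inner \<Rightarrow> 'b::complex_inner) \<Rightarrow> 'a set" where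
  "defect_space N = closure (range (defect N))"

definition proj :: "'a::complex_inner set \<Rightarrow> 'a \<Rightarrow> 'a" where
  "proj V x = (THE y. y \<in> V \<and> (\<forall>v\<in>V. cinner (x - y) v = 0))"

definition cspan :: "'a::complex_vector set \<Rightarrow> 'a set" where
  "cspan S = {x. \<exists>T c. finite T \<and> T \<subseteq> S \<and> x = (\<Sum>v\<in>T. scaleC (c v) v)}"

text \<open>For \<open>X\<close> mapping \<open>V\<close> into \<open>W\<close> (closed subspaces), the operator \<open>X|_V : V \<rightarrow> W\<close> is a
co-isometry, i.e. \<open>X|_V (X|_V)^* = I_W\<close>. Here \<open>(X|_V)^*\<close> is the adjoint of \<open>X \<circ> \<Pi>_V\<close>.\<close>
definition coisometry_on :: "'a::complex_inner set \<Rightarrow> 'b::complex_inner set \<Rightarrow> ('a \<Rightarrow> 'b) \<Rightarrow> bool" where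
  "coisometry_on V W X \<longleftrightarrow> X ` V \<subseteq> W \<and> (\<forall>y\<in>W. X (adj (\<lambda>x. X (proj V x)) y) = y)"

text \<open>\<open>\<K>'\<close> contains \<open>\<H>'\<close>: modelled by an isometric embedding \<open>J : \<H>' \<rightarrow> \<K>'\<close>;
then \<open>\<Pi>_{\<H>'} = J^*\<close>.\<close>
definition min_isometric_lifting ::
  "('g::chilbert \<Rightarrow> 'g) \<Rightarrow> ('g \<Rightarrow> 'k::chilbert) \<Rightarrow> ('k \<Rightarrow> 'k) \<Rightarrow> bool" where
  "min_isometric_lifting T' J U' \<longleftrightarrow>
     isometry J \<and> isometry U' \<and>
     closure (cspan (\<Union>n. range (\<lambda>h. (U' ^^ n) (J h)))) = UNIV \<and>
     (\<forall>k. adj J (U' k) = T' (adj J k))"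

definition data_set ::
  "('h::chilbert \<Rightarrow> 'g::chilbert) \<Rightarrow> ('g \<Rightarrow> 'g) \<Rightarrow> ('g \<Rightarrow> 'k::chilbert) \<Rightarrow> ('k \<Rightarrow> 'k)
   \<Rightarrow> ('z::chilbert \<Rightarrow> 'h) \<Rightarrow> ('z \<Rightarrow> 'h) \<Rightarrow> bool" where
  "data_set A T' J U' R Q \<longleftrightarrow>
     contraction A \<and> contraction T' \<and> min_isometric_lifting T' J U' \<and>
     bop R \<and> bop Q \<and> (\<forall>x. T' (A (R x)) = A (Q x)) \<and>
     (\<forall>x. Re (cinner (adj R (R x)) x) \<le> Re (cinner (adj Q (Q x)) x))"

definition contractive_interpolant ::
  "('h::chilbert \<Rightarrow> 'g::chilbert) \<Rightarrow> ('g \<Rightarrow> 'k::chilbert) \<Rightarrow> ('k \<Rightarrow> 'k)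
   \<Rightarrow> ('z::chilbert \<Rightarrow> 'h) \<Rightarrow> ('z \<Rightarrow> 'h) \<Rightarrow> ('h \<Rightarrow> 'k) \<Rightarrow> bool" where
  "contractive_interpolant A J U' R Q B \<longleftrightarrow>
     contraction B \<and> (\<forall>h. adj J (B h) = A h) \<and> (\<forall>x. U' (B (R x)) = B (Q x))"

definition F_space :: "('h::chilbert \<Rightarrow> 'g::chilbert) \<Rightarrow> ('z::chilbert \<Rightarrow> 'h) \<Rightarrow> 'h set" where
  "F_space A Q = closure (range (\<lambda>x. defect A (Q x)))"

text \<open>\<open>\<omega>_1 : \<F> \<rightarrow> \<D>_{T'}\<close>, extended by zero on \<open>\<F>^\<perp>\<close> (i.e. \<open>\<omega>_1 \<Pi>_\<F>\<close>).\<close>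
definition omega1 ::
  "('h::chilbert \<Rightarrow> 'g::chilbert) \<Rightarrow> ('g \<Rightarrow> 'g) \<Rightarrow> ('z::chilbert \<Rightarrow> 'h) \<Rightarrow> ('z \<Rightarrow> 'h) \<Rightarrow> 'h \<Rightarrow> 'g" where
  "omega1 A T' R Q = (THE w. bop w \<and> (\<forall>h. w h = w (proj (F_space A Q) h)) \<and>
                        (\<forall>x. w (defect A (Q x)) = defect T' (A (R x))))"

text \<open>\<open>\<omega>_2 : \<F> \<rightarrow> \<D>_A\<close>, extended by zero on \<open>\<F>^\<perp>\<close>.\<close>
definition omega2 ::
  "('h::chilbert \<Rightarrow> 'g::chilbert) \<Rightarrow> ('z::chilbert \<Rightarrow> 'h) \<Rightarrow> ('z \<Rightarrow> 'h) \<Rightarrow> 'h \<Rightarrow> 'h" where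
  "omega2 A R Q = (THE w. bop w \<and> (\<forall>h. w h = w (proj (F_space A Q) h)) \<and>
                     (\<forall>x. w (defect A (Q x)) = defect A (R x)))"

end

(* Write K' as the orthogonal sum of J H' and the spaces U'^n E D_{T'}, where E is isometric on D_{T'}
   with E D_{T'} h = U' J h - J T' h. The interpolants are B = J A + G D_A, where G is a contraction
   with values orthogonal to J H' and G = E omega_1 + U' G omega_2 on F; thus its coefficients
   G_n = E^* U'^{*n} G satisfy G_0 = omega_1 and G_{n+1} = G_n omega_2 on F. If F = D_A this determines
   them. If all omega_1 (P_F omega_2)^n are co-isometries then, inductively, each contraction G_n
   extends a co-isometry on F and so vanishes on the orthogonal complement of F.
   Conversely, every contraction Z = (Z_1, Z_2) extending omega gives an interpolant with coefficients
   Z_1 Z_2^n. If F is not D_A, comparing the extension of omega by zero with its rank-one perturbations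
   h |-> omega P_F h + <g,h> (v - omega omega^* v), g in D_A orthogonal to F, yields the co-isometry
   identities one after the other: v = (y, 0) for n = 0, and v = (0, x) with
   x = (omega_1 (P_F omega_2)^n)^* y for the step from n to n + 1. *)
theory Submission
  imports Defs
begin

section \<open>Inner products, projections and adjoints\<close>

text \<open>The direction \<open>p = v - \<omega> (adj \<omega> v)\<close> is chosen for
  contractivity. If D is the positive root of \<open>1 - \<omega> (adj \<omega>)\<close>, adding
  \<open>cinner g h\<close> times \<open>p\<close> off F is harmless as long as the rank-one
  operator built from \<open>p\<close> is dominated by D squared; since \<open>p\<close> is D
  squared applied to \<open>v\<close>, this holds up to the factor \<open>(norm v)^2\<close>, so
  scaling \<open>g\<close> suffices and D itself never has to be constructed. Because
  \<open>g\<close> is orthogonal to F, all coefficients of the zero extension vanish at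
  \<open>g\<close>. Comparing coefficients there makes the first component of \<open>p\<close>
  vanish, but of the second component q it only gives \<open>M n q = 0\<close> for all n. This
  weaker fact is enough, since \<open>adj (M (Suc n))\<close> is \<open>adj w2\<close> after
  \<open>adj (M n)\<close>: for \<open>x = adj (M n) y\<close> it says exactly that the identity
  passes from n to n + 1. Projections, adjoints, roots and the two components of \<omega> are
  definite descriptions, so each first needs existence and uniqueness: by distance minimization, by
  Riesz representation, by an iteration, and by extension from a dense range.\<close>

lemma cinner_add_right: "cinner x (y + z) = cinner x y + cinner x z"
  by (metis cinner_add_left cinner_commute complex_cnj_add)

lemma cinner_scaleC_right: "cinner x (scaleC a y) = a * cinner x y"
  by (metis cinner_commute cinner_scaleC_left complex_cnj_cnj complex_cnj_mult)

lemma cinner_self: "cinner x x = complex_of_real ((norm x)\<^sup>2)"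
proof -
  have "Im (cinner x x) = 0"
    using cinner_commute[of x x] by (metis complex_cnj cnj.simps(2) equal_neg_zero)
  then show ?thesis
    by (simp add: complex_eq_iff norm_eq_sqrt_cinner cinner_ge_zero)
qed

lemma cinner_zero_left [simp]: "cinner 0 x = 0"
  using cinner_add_left[of 0 0 x] by simp

lemma cinner_zero_right [simp]: "cinner x 0 = 0"
  using cinner_add_right[of x 0 0] by simp

lemma cinner_minus_left [simp]: "cinner (- x) y = - cinner x y"
  using cinner_add_left[of x "- x" y] by (simp add: eq_neg_iff_add_eq_0 add.commute)

lemma cinner_minus_right [simp]: "cinner x (- y) = - cinner x y"
  using cinner_add_right[of x y "- y"] by (simp add: eq_neg_iff_add_eq_0 add.commute)

lemma cinner_diff_left: "cinner (x - y) z = cinner x z - cinner y z"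
  using cinner_add_left[of x "- y" z] by simp

lemma cinner_diff_right: "cinner x (y - z) = cinner x y - cinner x z"
  using cinner_add_right[of x y "- z"] by simp

lemma cinner_scaleR_left: "cinner (r *\<^sub>R x) y = of_real r * cinner x y"
  by (simp add: scaleR_scaleC cinner_scaleC_left)

lemma cinner_scaleR_right: "cinner x (r *\<^sub>R y) = of_real r * cinner x y"
  by (simp add: scaleR_scaleC cinner_scaleC_right)

lemmas cinner_simps = cinner_add_left cinner_add_right cinner_diff_left cinner_diff_right
  cinner_scaleC_left cinner_scaleC_right cinner_scaleR_left cinner_scaleR_right

lemma Re_cinner_commute: "Re (cinner x y) = Re (cinner y x)"
  by (metis cinner_commute cnj.simps(1))

lemma cinner_eq_0_commute: "cinner x y = 0 \<longleftrightarrow> cinner y x = 0"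
  by (metis cinner_commute complex_cnj_zero)

lemma Re_cinner_self [simp]: "Re (cinner x x) = (norm x)\<^sup>2"
  by (simp add: cinner_self del: of_real_power)

lemma norm_add_sq: "(norm (x + y))\<^sup>2 = (norm x)\<^sup>2 + (norm y)\<^sup>2 + 2 * Re (cinner x y)"
  for x y :: "'a::complex_inner"
  unfolding Re_cinner_self[symmetric]
  using Re_cinner_commute[of x y] by (simp only: cinner_add_left cinner_add_right) simp

lemma norm_diff_sq: "(norm (x - y))\<^sup>2 = (norm x)\<^sup>2 + (norm y)\<^sup>2 - 2 * Re (cinner x y)"
  for x y :: "'a::complex_inner"
  using norm_add_sq[of x "- y"] by simp

lemma pythagoras: "cinner x y = 0 \<Longrightarrow> (norm (x + y))\<^sup>2 = (norm x)\<^sup>2 + (norm y)\<^sup>2"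
  by (simp add: norm_add_sq)

lemma norm_scaleC: "norm (scaleC a x) = cmod a * norm x" for x :: "'a::complex_inner"
proof -
  have "complex_of_real ((norm (scaleC a x))\<^sup>2) = cinner (scaleC a x) (scaleC a x)"
    by (simp only: cinner_self)
  also have "\<dots> = (a * cnj a) * cinner x x"
    by (simp add: cinner_scaleC_left cinner_scaleC_right)
  also have "\<dots> = complex_of_real ((cmod a * norm x)\<^sup>2)"
    by (simp add: cinner_self complex_norm_square[symmetric] power_mult_distrib)
  finally have "(norm (scaleC a x))\<^sup>2 = (cmod a * norm x)\<^sup>2"
    using of_real_eq_iff by blast
  then show ?thesis
    by (simp add: power2_eq_iff_nonneg)
qed

lemma cinner_cauchy_schwarz: "cmod (cinner x y) \<le> norm x * norm y"
proof (cases "y = 0")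
  case False
  define t where "t = cinner y x"
  define r where "r = (norm y)\<^sup>2"
  have r: "r > 0" using False by (simp add: r_def)
  have t2: "cinner x y = cnj t"
    unfolding t_def by (rule cinner_commute)
  \<comment> \<open>The vector is \<open>r\<close> times the component of \<open>x\<close>
    orthogonal to \<open>y\<close>; with the denominator cleared, only one positive factor
    \<open>r\<close> is left to cancel.\<close>
  have "0 \<le> (norm (r *\<^sub>R x - scaleC t y))\<^sup>2" by simp
  also have "\<dots> = r\<^sup>2 * (norm x)\<^sup>2 + (cmod t)\<^sup>2 * r - 2 * r * (cmod t)\<^sup>2"
  proof -
    have "cinner (r *\<^sub>R x) (scaleC t y) = of_real (r * (cmod t)\<^sup>2)"
      by (simp only: cinner_scaleR_left cinner_scaleC_right t2 of_real_mult complex_norm_square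
        mult.left_commute)
    then have "Re (cinner (r *\<^sub>R x) (scaleC t y)) = r * (cmod t)\<^sup>2"
      by (simp del: of_real_mult of_real_power)
    then show ?thesis
      by (simp add: norm_diff_sq norm_scaleC power_mult_distrib r_def)
  qed
  also have "\<dots> = r * (r * (norm x)\<^sup>2 - (cmod t)\<^sup>2)"
    by (simp add: power2_eq_square algebra_simps)
  finally have "(cmod t)\<^sup>2 \<le> r * (norm x)\<^sup>2"
    using r by (simp add: zero_le_mult_iff)
  then have "(cmod t)\<^sup>2 \<le> (norm x * norm y)\<^sup>2"
    by (simp add: r_def power_mult_distrib mult.commute)
  then show ?thesis
    using power2_le_imp_le by (fastforce simp: t2)
qed simp

text \<open>Over the reals the sesquilinear form is bilinear; this supplies its continuity, limits
  and finite sums.\<close>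

interpretation cinner: bounded_bilinear "cinner :: 'a::complex_inner \<Rightarrow> 'a \<Rightarrow> complex"
proof
  show "\<exists>K. \<forall>a b. norm (cinner a (b::'a)) \<le> norm a * norm b * K"
    by (intro exI[of _ 1]) (simp add: cinner_cauchy_schwarz)
qed (simp_all add: cinner_simps scaleR_conv_of_real)

lemma cinner_left_cancel: "(\<And>z. cinner x z = cinner y z) \<Longrightarrow> x = y"
  by (metis cinner_diff_left cinner_eq_zero_iff diff_self right_minus_eq)

lemma cinner_right_cancel: "(\<And>z. cinner z x = cinner z y) \<Longrightarrow> x = y"
  by (metis cinner_left_cancel cinner_commute)

section \<open>Linear maps and bounded operators\<close>

lemma clinear_simps:
  assumes "clinear f"
  shows "f (x + y) = f x + f y" "f (scaleC a x) = scaleC a (f x)" "f 0 = 0"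
    "f (- x) = - f x" "f (x - y) = f x - f y" "f (r *\<^sub>R x) = r *\<^sub>R f x"
proof -
  show add: "f (x + y) = f x + f y" and sc: "f (scaleC a x) = scaleC a (f x)" for x y a
    using assms by (auto simp: clinear_def)
  show 0: "f 0 = 0" using add[of 0 0] by simp
  show minus: "f (- x) = - f x" for x
    using add[of x "- x"] 0 by (simp add: eq_neg_iff_add_eq_0 add.commute)
  show "f (x - y) = f x - f y" using add[of x "- y"] minus by simp
  show "f (r *\<^sub>R x) = r *\<^sub>R f x" by (simp add: scaleR_scaleC sc)
qed

lemma clinearI:
  "(\<And>x y. f (x + y) = f x + f y) \<Longrightarrow> (\<And>a x. f (scaleC a x) = scaleC a (f x)) \<Longrightarrow> clinear f"
  by (simp add: clinear_def)

lemma bopI: "clinear f \<Longrightarrow> (\<And>x. norm (f x) \<le> K * norm x) \<Longrightarrow> bop f"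
  by (auto simp: bop_def)

lemma bop_clinear: "bop f \<Longrightarrow> clinear f"
  by (simp add: bop_def)

lemmas bop_simps = clinear_simps[OF bop_clinear]

lemma contraction_bop: "contraction f \<Longrightarrow> bop f"
  unfolding contraction_def by (auto intro: bopI[where K = 1])

lemma isometry_contraction: "isometry f \<Longrightarrow> contraction f"
  by (auto simp: isometry_def contraction_def)

lemma bop_bounded_linear: "bop f \<Longrightarrow> bounded_linear f"
proof -
  assume f: "bop f"
  then obtain K where "\<And>x. norm (f x) \<le> K * norm x" unfolding bop_def by blast
  then show "bounded_linear f"
    by (intro bounded_linear_intro[where K = K])
       (simp_all add: clinear_simps[OF bop_clinear[OF f]] mult.commute)
qed

lemmas bop_tendsto = bounded_linear.tendsto[OF bop_bounded_linear]

lemma bop_continuous: "bop f \<Longrightarrow> continuous_on S f"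
  by (intro linear_continuous_on bop_bounded_linear)

lemma bop_compose:
  assumes "bop f" "bop g"
  shows "bop (\<lambda>x. f (g x))"
proof -
  obtain K L where K: "\<And>x. norm (f x) \<le> K * norm x" and L: "\<And>x. norm (g x) \<le> L * norm x"
    using assms unfolding bop_def by blast
  have "norm (f (g x)) \<le> (\<bar>K\<bar> * \<bar>L\<bar>) * norm x" for x
  proof -
    have "norm (f (g x)) \<le> \<bar>K\<bar> * norm (g x)"
      using K[of "g x"] by (smt (verit) mult_right_mono norm_ge_zero)
    also have "\<dots> \<le> \<bar>K\<bar> * (\<bar>L\<bar> * norm x)"
      using L[of x] by (smt (verit) mult_left_mono mult_right_mono norm_ge_zero)
    finally show ?thesis by simp
  qed
  then show ?thesis
    using assms by (intro bopI[where K = "\<bar>K\<bar> * \<bar>L\<bar>"]) (simp_all add: clinear_def bop_def)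
qed

lemma bop_add:
  assumes "bop f" "bop g"
  shows "bop (\<lambda>x. f x + g x)"
proof -
  obtain K L where "\<And>x. norm (f x) \<le> K * norm x" "\<And>x. norm (g x) \<le> L * norm x"
    using assms unfolding bop_def by blast
  then have "norm (f x + g x) \<le> (K + L) * norm x" for x
    by (metis norm_triangle_le add_mono distrib_right)
  then show ?thesis
    using assms by (intro bopI[where K = "K + L"] clinearI)
      (simp_all add: bop_simps scaleC_add_right algebra_simps)
qed

lemma scaleC_minus_right: "scaleC a (- x) = - scaleC a (x::'a::complex_vector)"
proof -
  have "- x = scaleC (-1) x"
    using scaleR_scaleC[of "-1" x] by simp
  then show ?thesis
    using scaleR_scaleC[of "-1" "scaleC a x"] by (simp add: scaleC_scaleC)
qed

lemma scaleC_diff_right: "scaleC a (x - y) = scaleC a x - scaleC a (y::'a::complex_vector)"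
  using scaleC_add_right[of a x "- y"] by (simp add: scaleC_minus_right)

lemma bop_uminus: "bop f \<Longrightarrow> bop (\<lambda>x. - f x)"
  unfolding bop_def clinear_def by (simp add: scaleC_minus_right)

lemma bop_diff: "bop f \<Longrightarrow> bop g \<Longrightarrow> bop (\<lambda>x. f x - g x)"
  using bop_add[OF _ bop_uminus] by fastforce

lemma bop_id: "bop (\<lambda>x. x)"
  by (rule bopI[where K = 1]) (simp_all add: clinear_def)

lemma scaleC_zero_left [simp]: "scaleC 0 x = (0::'a::complex_vector)"
  using scaleC_add_left[of 0 0 x] by simp

lemma bop_cinner_scaleC: "bop (\<lambda>h. scaleC (cinner g h) p)"
proof (rule bopI[where K = "norm g * norm p"])
  show "norm (scaleC (cinner g h) p) \<le> norm g * norm p * norm h" for h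
    using mult_right_mono[OF cinner_cauchy_schwarz, of "norm p" g h]
    by (simp add: norm_scaleC algebra_simps)
qed (simp add: clinear_def cinner_simps scaleC_add_left scaleC_scaleC)

lemma bop_funpow:
  fixes f :: "'a::complex_inner \<Rightarrow> 'a"
  assumes "bop f"
  shows "bop (f ^^ n)"
proof (induction n)
  case 0
  have "f ^^ 0 = (\<lambda>x. x)" by (simp add: fun_eq_iff)
  then show ?case using bop_id by metis
next
  case (Suc n)
  have "f ^^ Suc n = (\<lambda>x. f ((f ^^ n) x))" by (simp add: fun_eq_iff)
  then show ?case using bop_compose[OF assms Suc] by metis
qed

lemma bop_eq_on_closure:
  assumes "bop f" "bop g" "\<And>x. x \<in> S \<Longrightarrow> f x = g x" "x \<in> closure S"
  shows "f x = g x"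
proof -
  have "closed {x. f x = g x}"
    using assms(1,2) by (intro closed_Collect_eq bop_continuous)
  then have "closure S \<subseteq> {x. f x = g x}"
    using assms(3) by (intro closure_minimal) auto
  then show ?thesis using assms(4) by blast
qed

section \<open>Complex subspaces and orthogonal projections\<close>

definition csubspace :: "'a::complex_vector set \<Rightarrow> bool" where
  "csubspace V \<longleftrightarrow> 0 \<in> V \<and> (\<forall>x\<in>V. \<forall>y\<in>V. x + y \<in> V) \<and> (\<forall>a. \<forall>x\<in>V. scaleC a x \<in> V)"

lemma csubspace_diff: "csubspace V \<Longrightarrow> x \<in> V \<Longrightarrow> y \<in> V \<Longrightarrow> x - y \<in> V"
  unfolding csubspace_def
  by (metis add_uminus_conv_diff scaleR_scaleC scaleR_minus1_left)

lemma csubspace_scaleR: "csubspace V \<Longrightarrow> x \<in> V \<Longrightarrow> r *\<^sub>R x \<in> V"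
  unfolding csubspace_def by (simp add: scaleR_scaleC)

lemma csubspace_range: "clinear f \<Longrightarrow> csubspace (range f)"
  unfolding csubspace_def by (auto simp: image_iff)
    (metis clinear_simps(3) clinear_simps(1) clinear_simps(2))+

lemma bop_scaleC: "bop (\<lambda>x. scaleC a x)"
  by (rule bopI[where K = "cmod a"])
     (simp_all add: clinear_def norm_scaleC scaleC_add_right scaleC_scaleC mult.commute)

lemma csubspace_closure:
  fixes V :: "'a::complex_inner set"
  assumes "csubspace V"
  shows "csubspace (closure V)"
  unfolding csubspace_def
proof (intro conjI ballI allI)
  show "0 \<in> closure V"
    using assms closure_subset unfolding csubspace_def by blast
next
  fix x y assume "x \<in> closure V" "y \<in> closure V"
  then obtain f g where f: "\<And>n. f n \<in> V" "f \<longlonglongrightarrow> x" and g: "\<And>n. g n \<in> V" "g \<longlonglongrightarrow> y"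
    unfolding closure_sequential by blast
  then show "x + y \<in> closure V"
    unfolding closure_sequential using assms unfolding csubspace_def
    by (intro exI[of _ "\<lambda>n. f n + g n"]) (auto intro: tendsto_add)
next
  fix a x assume "x \<in> closure V"
  then obtain f where f: "\<And>n. f n \<in> V" "f \<longlonglongrightarrow> x"
    unfolding closure_sequential by blast
  then show "scaleC a x \<in> closure V"
    unfolding closure_sequential using assms unfolding csubspace_def
    by (intro exI[of _ "\<lambda>n. scaleC a (f n)"]) (auto intro: bop_tendsto[OF bop_scaleC])
qed

text \<open>A minimizing sequence for the distance to \<open>V\<close> is Cauchy by the
  parallelogram law, because midpoints stay in \<open>V\<close>. At the minimizer no direction of
  \<open>V\<close> shortens the distance, which is orthogonality.\<close>

lemma projection_exists:
  fixes V :: "'a::chilbert set"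
  assumes V: "csubspace V" "closed V"
  shows "\<exists>y\<in>V. \<forall>v\<in>V. cinner (x - y) v = 0"
proof -
  define d where "d = (INF v\<in>V. (norm (x - v))\<^sup>2)"
  have V0: "V \<noteq> {}" using V by (auto simp: csubspace_def)
  have bdd: "bdd_below ((\<lambda>v. (norm (x - v))\<^sup>2) ` V)"
    by (intro bdd_belowI[of _ 0]) auto
  have dle: "d \<le> (norm (x - v))\<^sup>2" if "v \<in> V" for v
    unfolding d_def using bdd that by (rule cINF_lower)
  have "\<exists>v\<in>V. (norm (x - v))\<^sup>2 < d + inverse (real (Suc n))" for n
    using cINF_less_iff[OF V0 bdd, of "d + inverse (real (Suc n))"] by (simp add: d_def)
  then obtain v where v: "\<And>n. v n \<in> V"
      and vd: "\<And>n. (norm (x - v n))\<^sup>2 < d + inverse (real (Suc n))"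
    by metis
  have par: "(norm (v n - v m))\<^sup>2 \<le> 2 * inverse (real (Suc n)) + 2 * inverse (real (Suc m))" for n m
  proof -
    let ?a = "x - v n" and ?b = "x - v m"
    have "(norm (?a - ?b))\<^sup>2 + (norm (?a + ?b))\<^sup>2 = 2 * (norm ?a)\<^sup>2 + 2 * (norm ?b)\<^sup>2"
      by (simp only: norm_add_sq[of ?a ?b] norm_diff_sq[of ?a ?b])
    moreover have "?a + ?b = 2 *\<^sub>R (x - (1/2) *\<^sub>R (v n + v m))"
      by (simp add: algebra_simps scaleR_2)
    then have "(norm (?a + ?b))\<^sup>2 = 4 * (norm (x - (1/2) *\<^sub>R (v n + v m)))\<^sup>2"
      by (simp add: power_mult_distrib)
    moreover have "(1/2) *\<^sub>R (v n + v m) \<in> V"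
      using v V(1) csubspace_scaleR unfolding csubspace_def by blast
    then have "d \<le> (norm (x - (1/2) *\<^sub>R (v n + v m)))\<^sup>2" by (rule dle)
    moreover have "norm (v n - v m) = norm (?a - ?b)"
      by (simp add: norm_minus_commute)
    ultimately show ?thesis
      using vd[of n] vd[of m] by simp
  qed
  have "Cauchy v"
  proof (rule metric_CauchyI)
    fix e :: real assume e: "0 < e"
    obtain N where N: "inverse (real (Suc N)) < e\<^sup>2 / 4"
      using reals_Archimedean[of "e\<^sup>2 / 4"] e by auto
    have "dist (v m) (v n) < e" if "m \<ge> N" "n \<ge> N" for m n
    proof -
      have "inverse (real (Suc m)) \<le> inverse (real (Suc N))"
           "inverse (real (Suc n)) \<le> inverse (real (Suc N))"
        using that by (simp_all add: field_simps)
      then have "(norm (v m - v n))\<^sup>2 < e\<^sup>2"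
        using par[of m n] N by linarith
      then show ?thesis
        using e by (simp add: dist_norm power_less_imp_less_base)
    qed
    then show "\<exists>M. \<forall>m\<ge>M. \<forall>n\<ge>M. dist (v m) (v n) < e" by blast
  qed
  then obtain y where y: "v \<longlonglongrightarrow> y"
    using Cauchy_convergent convergent_def by blast
  have yV: "y \<in> V"
    using V(2) v y closed_sequentially by blast
  have yd: "(norm (x - y))\<^sup>2 \<le> d"
  proof (rule LIMSEQ_le)
    show "(\<lambda>n. (norm (x - v n))\<^sup>2) \<longlonglongrightarrow> (norm (x - y))\<^sup>2"
      by (intro tendsto_intros y)
    show "(\<lambda>n. d + inverse (real (Suc n))) \<longlonglongrightarrow> d"
      using tendsto_add[OF tendsto_const LIMSEQ_inverse_real_of_nat] by fastforce
    show "\<exists>N. \<forall>n\<ge>N. (norm (x - v n))\<^sup>2 \<le> d + inverse (real (Suc n))"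
      using vd less_imp_le by blast
  qed
  have "cinner (x - y) w = 0" if w: "w \<in> V" for w
  proof -
    \<comment> \<open>The competitor moves \<open>y\<close> by \<open>r c w\<close> with
      \<open>r (norm w)^2 \<le> 1\<close>, so the quadratic term cannot offset the linear gain. The
      \<open>+ 1\<close> in \<open>r\<close> covers \<open>w = 0\<close>.\<close>
    define c where "c = cinner w (x - y)"
    define r where "r = 1 / ((norm w)\<^sup>2 + 1)"
    have pos: "0 < (norm w)\<^sup>2 + 1"
      by (smt (verit) zero_le_power2)
    have cc: "cinner (x - y) w = cnj c"
      unfolding c_def by (rule cinner_commute)
    have "y + scaleC (of_real r * c) w \<in> V"
      using yV w V(1) by (simp add: csubspace_def)
    then have "(norm (x - y))\<^sup>2 \<le> (norm ((x - y) - scaleC (of_real r * c) w))\<^sup>2"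
      using dle yd by (metis diff_diff_eq order_trans)
    also have "\<dots> = (norm (x - y))\<^sup>2 + r\<^sup>2 * (cmod c)\<^sup>2 * (norm w)\<^sup>2 - 2 * (r * (cmod c)\<^sup>2)"
    proof -
      have "cinner (x - y) (scaleC (of_real r * c) w) = of_real (r * (cmod c)\<^sup>2)"
        by (simp only: cinner_scaleC_right cc of_real_mult complex_norm_square mult.assoc)
      then have "Re (cinner (x - y) (scaleC (of_real r * c) w)) = r * (cmod c)\<^sup>2"
        by (simp del: of_real_mult of_real_power)
      then show ?thesis
        by (simp only: norm_diff_sq[of "x - y"]) (simp add: norm_scaleC norm_mult power_mult_distrib)
    qed
    finally have "2 * (r * (cmod c)\<^sup>2) \<le> r * (cmod c)\<^sup>2 * (r * (norm w)\<^sup>2)"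
      by (simp add: power2_eq_square algebra_simps)
    also have "\<dots> \<le> r * (cmod c)\<^sup>2 * 1"
      using pos by (intro mult_left_mono) (auto simp: r_def divide_simps)
    finally have "r * (cmod c)\<^sup>2 \<le> 0" by simp
    then have "c = 0"
      using pos by (simp add: r_def mult_le_0_iff divide_le_0_iff)
    then show ?thesis by (simp add: cc)
  qed
  with yV show ?thesis by blast
qed

lemma proj_unique:
  fixes V :: "'a::complex_inner set"
  assumes "csubspace V" "y \<in> V" "\<And>v. v \<in> V \<Longrightarrow> cinner (x - y) v = 0"
  shows "proj V x = y"
  unfolding proj_def
proof (rule the_equality)
  show "y \<in> V \<and> (\<forall>v\<in>V. cinner (x - y) v = 0)" using assms by blast
next
  fix z assume z: "z \<in> V \<and> (\<forall>v\<in>V. cinner (x - z) v = 0)"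
  then have "y - z \<in> V" using assms csubspace_diff by blast
  then have "cinner ((x - z) - (x - y)) (y - z) = 0"
    using z assms(3) by (simp only: cinner_diff_left[of "x - z"]) simp
  moreover have "(x - z) - (x - y) = y - z" by simp
  ultimately show "z = y" by (simp add: cinner_eq_zero_iff)
qed

context
  fixes V :: "'a::chilbert set"
  assumes V: "csubspace V" "closed V"
begin

lemma proj_in: "proj V x \<in> V"
  and proj_orth: "v \<in> V \<Longrightarrow> cinner (x - proj V x) v = 0"
proof -
  obtain y where y: "y \<in> V" "\<And>v. v \<in> V \<Longrightarrow> cinner (x - y) v = 0"
    using projection_exists[OF V, of x] by blast
  then have "proj V x = y" by (rule proj_unique[OF V(1)])
  with y show "proj V x \<in> V" and "v \<in> V \<Longrightarrow> cinner (x - proj V x) v = 0" by simp_all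
qed

lemma proj_orth': "v \<in> V \<Longrightarrow> cinner v (x - proj V x) = 0"
  using proj_orth cinner_eq_0_commute by blast

lemma proj_fixed: "x \<in> V \<Longrightarrow> proj V x = x"
  by (rule proj_unique) (use V in auto)

lemma proj_idem [simp]: "proj V (proj V x) = proj V x"
  by (simp add: proj_fixed proj_in)

lemma proj_norm_sq: "(norm x)\<^sup>2 = (norm (proj V x))\<^sup>2 + (norm (x - proj V x))\<^sup>2"
  using pythagoras[OF proj_orth', of "proj V x" x] by (simp add: proj_in)

lemma proj_norm_le: "norm (proj V x) \<le> norm x"
  by (rule power2_le_imp_le) (use proj_norm_sq[of x] in auto)

lemma proj_clinear: "clinear (proj V)"
proof (rule clinearI)
  fix x y :: 'a and a
  show "proj V (x + y) = proj V x + proj V y"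
  proof (rule proj_unique)
    show "proj V x + proj V y \<in> V" using V(1) proj_in unfolding csubspace_def by blast
    fix v assume "v \<in> V"
    then have "cinner ((x - proj V x) + (y - proj V y)) v = 0"
      by (simp add: cinner_add_left proj_orth)
    then show "cinner (x + y - (proj V x + proj V y)) v = 0" by (simp add: algebra_simps)
  qed (rule V)
  show "proj V (scaleC a x) = scaleC a (proj V x)"
  proof (rule proj_unique)
    show "scaleC a (proj V x) \<in> V" using V(1) proj_in unfolding csubspace_def by blast
    fix v assume "v \<in> V"
    then have "cinner (scaleC a (x - proj V x)) v = 0"
      by (simp add: cinner_scaleC_left proj_orth)
    then show "cinner (scaleC a x - scaleC a (proj V x)) v = 0" by (simp add: scaleC_diff_right)
  qed (rule V)
qed

end

section \<open>Adjoints by Riesz representation\<close>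

lemma adjoint_exists:
  fixes f :: "'a::chilbert \<Rightarrow> 'b::complex_inner"
  assumes f: "bop f"
  shows "\<exists>g. \<forall>x. cinner (f x) y = cinner x g"
proof (cases "\<forall>x. cinner y (f x) = 0")
  case True
  then show ?thesis
    by (intro exI[of _ 0]) (metis cinner_eq_0_commute cinner_zero_right)
next
  case False
  let ?phi = "\<lambda>x. cinner y (f x)"
  let ?N = "{x. ?phi x = 0}"
  have N: "csubspace ?N"
    by (simp add: csubspace_def bop_simps[OF f] cinner_simps)
  have N': "closed ?N"
    by (intro closed_Collect_eq cinner.continuous_on continuous_on_const bop_continuous f)
  obtain x0 where x0: "?phi x0 \<noteq> 0" using False by blast
  define z where "z = x0 - proj ?N x0"
  have z: "cinner z v = 0" if "?phi v = 0" for v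
    unfolding z_def by (rule proj_orth[OF N N']) (use that in simp)
  have "?phi (proj ?N x0) = 0" using proj_in[OF N N', of x0] by simp
  then have z0: "z \<noteq> 0" using x0 by (auto simp: z_def)
  have "cinner (f x) y = cinner x (scaleC (cnj (?phi z / of_real ((norm z)\<^sup>2))) z)" for x
  proof -
    \<comment> \<open>The combination lies in the kernel, hence is orthogonal to \<open>z\<close>;
      solving for \<open>?phi x\<close> exhibits the Riesz vector as a multiple of
      \<open>z\<close>.\<close>
    have "?phi (scaleC (?phi z) x - scaleC (?phi x) z) = 0"
      by (simp add: bop_simps[OF f] cinner_simps)
    then have "cinner z (scaleC (?phi z) x - scaleC (?phi x) z) = 0" by (rule z)
    then have "?phi z * cinner z x = ?phi x * of_real ((norm z)\<^sup>2)"
      by (simp only: cinner_simps cinner_self) simp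
    then have "?phi x = ?phi z / of_real ((norm z)\<^sup>2) * cinner z x"
      using z0 by (simp add: field_simps)
    then have "cnj (?phi x) = cnj (?phi z / of_real ((norm z)\<^sup>2)) * cnj (cinner z x)"
      by simp
    then show ?thesis
      by (simp only: cinner_scaleC_right cinner_commute[symmetric])
  qed
  then show ?thesis by blast
qed

lemma adj_eqI:
  assumes "\<And>x y. cinner (f x) y = cinner x (g y)"
  shows "adj f = g"
  unfolding adj_def
proof (rule the_equality)
  show "h = g" if "\<forall>x y. cinner (f x) y = cinner x (h y)" for h
    using that assms by (intro ext cinner_right_cancel) metis
qed (use assms in blast)

lemma cinner_adj:
  fixes f :: "'a::chilbert \<Rightarrow> 'b::complex_inner"
  assumes "bop f"
  shows "cinner (f x) y = cinner x (adj f y)"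
proof -
  obtain g where "\<And>x y. cinner (f x) y = cinner x (g y)"
    using adjoint_exists[OF assms] by metis
  then show ?thesis using adj_eqI by metis
qed

lemma cinner_adj':
  fixes f :: "'a::chilbert \<Rightarrow> 'b::complex_inner"
  assumes "bop f"
  shows "cinner y (f x) = cinner (adj f y) x"
  by (metis cinner_adj[OF assms] cinner_commute)

lemma bop_adj:
  fixes f :: "'a::chilbert \<Rightarrow> 'b::complex_inner"
  assumes f: "bop f"
  shows "bop (adj f)"
proof -
  obtain K where K: "\<And>x. norm (f x) \<le> K * norm x"
    using f unfolding bop_def by blast
  have lin: "clinear (adj f)"
    by (intro clinearI cinner_right_cancel)
       (simp_all add: cinner_simps cinner_adj[OF f, symmetric])
  have "norm (adj f y) \<le> \<bar>K\<bar> * norm y" for y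
  proof (cases "adj f y = 0")
    case False
    have "(norm (adj f y))\<^sup>2 = cmod (cinner (f (adj f y)) y)"
      by (simp add: cinner_adj[OF f] cinner_self norm_power)
    also have "\<dots> \<le> norm (f (adj f y)) * norm y"
      by (rule cinner_cauchy_schwarz)
    also have "\<dots> \<le> (\<bar>K\<bar> * norm (adj f y)) * norm y"
      using K[of "adj f y"]
      by (intro mult_right_mono) (auto intro: order_trans[OF _ mult_right_mono[OF abs_ge_self]])
    finally show ?thesis
      using False by (simp add: power2_eq_square ac_simps)
  qed simp
  then show ?thesis using lin by (rule bopI[rotated])
qed

lemma contraction_adj_norm:
  fixes f :: "'a::chilbert \<Rightarrow> 'b::complex_inner"
  assumes "contraction f"
  shows "norm (adj f y) \<le> norm y"
proof (cases "adj f y = 0")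
  case False
  have f: "bop f" by (rule contraction_bop[OF assms])
  have "(norm (adj f y))\<^sup>2 = cmod (cinner (f (adj f y)) y)"
    by (simp add: cinner_adj[OF f] cinner_self norm_power)
  also have "\<dots> \<le> norm (f (adj f y)) * norm y"
    by (rule cinner_cauchy_schwarz)
  also have "\<dots> \<le> norm (adj f y) * norm y"
    using assms by (intro mult_right_mono) (auto simp: contraction_def)
  finally show ?thesis using False by (simp add: power2_eq_square)
qed simp

section \<open>Square roots and defect operators\<close>

primrec sqrt_iter :: "('a::real_vector \<Rightarrow> 'a) \<Rightarrow> nat \<Rightarrow> 'a \<Rightarrow> 'a" where
  "sqrt_iter X 0 h = 0"
| "sqrt_iter X (Suc n) h = (1/2) *\<^sub>R (X h + sqrt_iter X n (sqrt_iter X n h))"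

text \<open>This is the scalar iteration for \<open>X = 1\<close>. It majorizes the norms of the
  operator iterates and of their increments, so their convergence reduces to that of a bounded
  increasing real sequence.\<close>

primrec sqrt_iter_bound :: "nat \<Rightarrow> real" where
  "sqrt_iter_bound 0 = 0"
| "sqrt_iter_bound (Suc n) = (1 + (sqrt_iter_bound n)\<^sup>2) / 2"

lemma sqrt_iter_bound_range: "0 \<le> sqrt_iter_bound n \<and> sqrt_iter_bound n \<le> 1"
proof (induction n)
  case (Suc n)
  then have "(sqrt_iter_bound n)\<^sup>2 \<le> 1" by (simp add: power_le_one)
  then show ?case by simp
qed simp

lemma sqrt_iter_bound_mono: "sqrt_iter_bound n \<le> sqrt_iter_bound (Suc n)"
  using zero_le_power2[of "sqrt_iter_bound n - 1"] by (simp add: power2_eq_square algebra_simps)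

lemma sqrt_iter_bound_Cauchy: "Cauchy sqrt_iter_bound"
proof -
  have "incseq sqrt_iter_bound" using sqrt_iter_bound_mono by (rule incseq_SucI)
  then obtain L where "sqrt_iter_bound \<longlonglongrightarrow> L"
    using incseq_convergent[of sqrt_iter_bound 1] sqrt_iter_bound_range by blast
  then show ?thesis using LIMSEQ_imp_Cauchy by blast
qed

context
  fixes X :: "'a::chilbert \<Rightarrow> 'a"
  assumes X: "contraction X" and X_sym: "\<And>x y. cinner (X x) y = cinner x (X y)"
begin

lemma sqrt_iter_clinear: "clinear (sqrt_iter X n)"
proof (induction n)
  case 0
  then show ?case by (simp add: clinear_def bop_simps[OF bop_scaleC])
next
  case (Suc n)
  have 1: "clinear X" using X by (simp add: contraction_def)
  show ?case
    by (rule clinearI)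
      (simp_all add: clinear_simps[OF Suc] clinear_simps[OF 1] algebra_simps scaleC_add_right
        scaleR_scaleC scaleC_scaleC)
qed

lemma sqrt_iter_norm: "norm (sqrt_iter X n h) \<le> sqrt_iter_bound n * norm h"
proof (induction n arbitrary: h)
  case (Suc n)
  have "norm (sqrt_iter X n (sqrt_iter X n h)) \<le> sqrt_iter_bound n * (sqrt_iter_bound n * norm h)"
    using Suc[of "sqrt_iter X n h"] mult_left_mono[OF Suc[of h], of "sqrt_iter_bound n"]
      sqrt_iter_bound_range[of n] by simp
  moreover have "norm (X h) \<le> norm h" using X by (simp add: contraction_def)
  ultimately have "norm (X h + sqrt_iter X n (sqrt_iter X n h))
      \<le> norm h + sqrt_iter_bound n * (sqrt_iter_bound n * norm h)"
    by (metis norm_triangle_le add_mono)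
  then show ?case by (simp add: power2_eq_square mult.assoc distrib_right del: scaleR_add_right)
qed simp

lemma sqrt_iter_norm_le: "norm (sqrt_iter X n h) \<le> norm h"
  using sqrt_iter_norm[of n h] sqrt_iter_bound_range[of n]
  by (meson mult_left_le_one_le norm_ge_zero order_trans)

lemma sqrt_iter_sym: "cinner (sqrt_iter X n x) y = cinner x (sqrt_iter X n y)"
proof (induction n arbitrary: x y)
  case (Suc n)
  have "cinner (sqrt_iter X n (sqrt_iter X n x)) y = cinner x (sqrt_iter X n (sqrt_iter X n y))"
    by (simp only: Suc)
  then show ?case by (simp add: cinner_simps X_sym)
qed simp

text \<open>The difference of squares is split as \<open>Y (Y - Z) + (Y - Z) Z\<close>, which
  requires no commutation; the scalar bounds then recombine to the same difference of
  squares.\<close>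

lemma sqrt_iter_step:
  "norm (sqrt_iter X (Suc n) h - sqrt_iter X n h)
    \<le> (sqrt_iter_bound (Suc n) - sqrt_iter_bound n) * norm h"
proof (induction n arbitrary: h)
  case 0
  have "norm (X h) \<le> norm h" using X by (simp add: contraction_def)
  then show ?case by (simp add: clinear_simps[OF sqrt_iter_clinear[of 0]])
next
  case (Suc n)
  let ?Y = "sqrt_iter X (Suc n)" and ?Z = "sqrt_iter X n"
  let ?y = "sqrt_iter_bound (Suc n)" and ?z = "sqrt_iter_bound n"
  have bounds: "0 \<le> ?y" "0 \<le> ?z" "0 \<le> ?y - ?z"
    using sqrt_iter_bound_range[of "Suc n"] sqrt_iter_bound_range[of n]
      sqrt_iter_bound_mono[of n] by linarith+
  have "norm (?Y (?Y h - ?Z h)) \<le> ?y * ((?y - ?z) * norm h)"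
    using sqrt_iter_norm[of "Suc n" "?Y h - ?Z h"] mult_left_mono[OF Suc[of h] bounds(1)]
    by linarith
  moreover have "norm (?Y (?Z h) - ?Z (?Z h)) \<le> (?y - ?z) * (?z * norm h)"
    using Suc[of "?Z h"] mult_left_mono[OF sqrt_iter_norm[of n h] bounds(3)] by linarith
  ultimately have "norm (?Y (?Y h - ?Z h) + (?Y (?Z h) - ?Z (?Z h)))
      \<le> ?y * ((?y - ?z) * norm h) + (?y - ?z) * (?z * norm h)"
    by (rule norm_triangle_le[OF add_mono])
  also have "\<dots> = (?y\<^sup>2 - ?z\<^sup>2) * norm h"
    by (simp only: power2_eq_square algebra_simps)
  finally have *: "norm (?Y (?Y h) - ?Z (?Z h)) \<le> (?y\<^sup>2 - ?z\<^sup>2) * norm h"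
    by (simp only: clinear_simps[OF sqrt_iter_clinear]) simp
  have "sqrt_iter X (Suc (Suc n)) h - ?Y h = (1/2) *\<^sub>R (?Y (?Y h) - ?Z (?Z h))"
    by (simp only: sqrt_iter.simps(2)[of X "Suc n"] sqrt_iter.simps(2)[of X n h]
        scaleR_diff_right[symmetric] add_diff_cancel_left)
  then have "norm (sqrt_iter X (Suc (Suc n)) h - ?Y h) = norm (?Y (?Y h) - ?Z (?Z h)) / 2"
    by simp
  moreover have "sqrt_iter_bound (Suc (Suc n)) - ?y = (?y\<^sup>2 - ?z\<^sup>2) / 2"
    by (simp only: sqrt_iter_bound.simps(2)[of "Suc n"] sqrt_iter_bound.simps(2)[of n])
       (simp add: diff_divide_distrib add_divide_distrib)
  moreover have "norm (?Y (?Y h) - ?Z (?Z h)) / 2 \<le> (?y\<^sup>2 - ?z\<^sup>2) / 2 * norm h"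
    using divide_right_mono[OF *, of 2] by (simp only: times_divide_eq_left zero_le_numeral)
  ultimately show ?case by (simp only:)
qed

lemma sqrt_iter_diff:
  "norm (sqrt_iter X (n + k) h - sqrt_iter X n h)
    \<le> (sqrt_iter_bound (n + k) - sqrt_iter_bound n) * norm h"
proof (induction k)
  case (Suc k)
  have "norm (sqrt_iter X (n + Suc k) h - sqrt_iter X n h)
      \<le> norm (sqrt_iter X (Suc (n + k)) h - sqrt_iter X (n + k) h)
        + norm (sqrt_iter X (n + k) h - sqrt_iter X n h)"
    by (metis add_Suc_right diff_add_cancel norm_triangle_ineq add_diff_eq)
  then show ?case
    using Suc sqrt_iter_step[of "n + k" h] by (simp only: left_diff_distrib add_Suc_right)
qed simp

lemma sqrt_iter_convergent: "convergent (\<lambda>n. sqrt_iter X n h)"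
proof -
  have "Cauchy (\<lambda>n. sqrt_iter X n h)"
  proof (rule CauchyI')
    fix e :: real assume e: "0 < e"
    have n: "0 < norm h + 1" by (simp add: add_nonneg_pos)
    obtain M where M: "\<And>m n. m \<ge> M \<Longrightarrow> n \<ge> M
        \<Longrightarrow> norm (sqrt_iter_bound m - sqrt_iter_bound n) < e / (norm h + 1)"
      using CauchyD[OF sqrt_iter_bound_Cauchy, of "e / (norm h + 1)"] e n by auto
    have "norm (sqrt_iter X m h - sqrt_iter X n h) < e" if "m \<ge> M" "n > m" for m n
    proof -
      let ?d = "sqrt_iter_bound n - sqrt_iter_bound m"
      have *: "norm (sqrt_iter X n h - sqrt_iter X m h) \<le> ?d * norm h"
        using sqrt_iter_diff[of m "n - m" h] that by simp
      have d: "\<bar>?d\<bar> < e / (norm h + 1)" using M[of n m] that by simp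
      have "?d * norm h \<le> \<bar>?d\<bar> * (norm h + 1)"
        by (intro mult_mono) auto
      also have "\<dots> < e" using d n by (simp add: pos_less_divide_eq)
      finally show ?thesis using * by (simp add: norm_minus_commute)
    qed
    then show "\<exists>M. \<forall>m\<ge>M. \<forall>n>m. dist (sqrt_iter X m h) (sqrt_iter X n h) < e"
      unfolding dist_norm by blast
  qed
  then show ?thesis by (rule Cauchy_convergent)
qed

text \<open>The iteration for \<open>Y = (X + Y\<^sup>2) / 2\<close> converges, and then \<open>(1 - Y)\<^sup>2 = 1 - X\<close>.\<close>

lemma sqrt_exists:
  "\<exists>S. bop S \<and> positive_op S \<and> (\<forall>h. S (S h) = h - X h) \<and>
    (\<forall>C. bop C \<longrightarrow> (\<forall>h. C (X h) = X (C h)) \<longrightarrow> (\<forall>h. C (S h) = S (C h)))"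
proof -
  define Y where "Y h = lim (\<lambda>n. sqrt_iter X n h)" for h
  have Y: "(\<lambda>n. sqrt_iter X n h) \<longlonglongrightarrow> Y h" for h
    unfolding Y_def using sqrt_iter_convergent convergent_LIMSEQ_iff by blast
  have lin: "clinear Y"
  proof (rule clinearI)
    fix x y a
    have "(\<lambda>n. sqrt_iter X n (x + y)) \<longlonglongrightarrow> Y x + Y y"
      using tendsto_add[OF Y[of x] Y[of y]] by (simp add: clinear_simps[OF sqrt_iter_clinear])
    then show "Y (x + y) = Y x + Y y" by (rule LIMSEQ_unique[OF Y])
    have "(\<lambda>n. sqrt_iter X n (scaleC a x)) \<longlonglongrightarrow> scaleC a (Y x)"
      using bop_tendsto[OF bop_scaleC Y[of x]] by (simp add: clinear_simps[OF sqrt_iter_clinear])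
    then show "Y (scaleC a x) = scaleC a (Y x)" by (rule LIMSEQ_unique[OF Y])
  qed
  have Y_norm: "norm (Y h) \<le> norm h" for h
    by (rule LIMSEQ_le_const2[OF tendsto_norm[OF Y]]) (use sqrt_iter_norm_le in blast)
  have Y_bop: "bop Y" by (rule bopI[where K = 1, OF lin]) (simp add: Y_norm)
  have Y_sym: "cinner (Y x) y = cinner x (Y y)" for x y
    using LIMSEQ_unique[OF cinner.tendsto[OF Y[of x] tendsto_const[of y]]]
      cinner.tendsto[OF tendsto_const[of x] Y[of y]] by (simp add: sqrt_iter_sym)
  \<comment> \<open>All iterates have norm at most 1, so applying the n-th one to the null sequence
    of errors again gives a null sequence.\<close>
  have YY: "(\<lambda>n. sqrt_iter X n (sqrt_iter X n h)) \<longlonglongrightarrow> Y (Y h)" for h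
  proof (rule Lim_transform2)
    show "(\<lambda>n. sqrt_iter X n (Y h)) \<longlonglongrightarrow> Y (Y h)" by (rule Y)
    have "(\<lambda>n. sqrt_iter X n h - Y h) \<longlonglongrightarrow> 0"
      using tendsto_diff[OF Y[of h] tendsto_const[of "Y h"]] by simp
    then have "(\<lambda>n. sqrt_iter X n (sqrt_iter X n h - Y h)) \<longlonglongrightarrow> 0"
      by (rule Lim_null_comparison[rotated, OF tendsto_norm_zero])
         (simp add: sqrt_iter_norm_le)
    then show "(\<lambda>n. sqrt_iter X n (Y h) - sqrt_iter X n (sqrt_iter X n h)) \<longlonglongrightarrow> 0"
      using tendsto_minus by (fastforce simp: clinear_simps[OF sqrt_iter_clinear])
  qed
  have fix_eq: "Y h = (1/2) *\<^sub>R (X h + Y (Y h))" for h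
  proof (rule LIMSEQ_unique)
    show "(\<lambda>n. sqrt_iter X (Suc n) h) \<longlonglongrightarrow> Y h"
      using Y[of h] by (rule LIMSEQ_Suc)
    show "(\<lambda>n. sqrt_iter X (Suc n) h) \<longlonglongrightarrow> (1/2) *\<^sub>R (X h + Y (Y h))"
      unfolding sqrt_iter.simps by (intro tendsto_intros YY)
  qed
  let ?S = "\<lambda>h. h - Y h"
  have "bop ?S" by (rule bop_diff[OF bop_id Y_bop])
  moreover have "positive_op ?S"
    unfolding positive_op_def
  proof (intro allI conjI)
    fix x
    have "Im (cinner (?S x) x) = 0"
      using cinner_commute[of "?S x" x] Y_sym[of x x]
      by (metis cinner_diff_left cinner_diff_right cnj.simps(2) equal_neg_zero)
    then show "cinner (?S x) x = complex_of_real (Re (cinner (?S x) x))"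
      by (simp add: complex_eq_iff)
    have "Re (cinner (Y x) x) \<le> cmod (cinner (Y x) x)" by (rule complex_Re_le_cmod)
    also have "\<dots> \<le> norm (Y x) * norm x" by (rule cinner_cauchy_schwarz)
    also have "\<dots> \<le> (norm x)\<^sup>2" by (simp add: power2_eq_square mult_right_mono Y_norm)
    finally show "0 \<le> Re (cinner (?S x) x)" by (simp add: cinner_diff_left)
  qed
  moreover have "?S (?S h) = h - X h" for h
  proof -
    have "2 *\<^sub>R Y h = X h + Y (Y h)" by (subst fix_eq) simp
    then show ?thesis by (simp add: clinear_simps[OF lin] scaleR_2 algebra_simps)
  qed
  \<comment> \<open>The iterates are polynomials in \<open>X\<close>, so whatever commutes with
    \<open>X\<close> commutes with their limit. Uniqueness of the root of a defect will rest on
    this.\<close>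
  moreover have "C (?S h) = ?S (C h)" if C: "bop C" and comm: "\<And>h. C (X h) = X (C h)" for C h
  proof -
    have "C (sqrt_iter X n h) = sqrt_iter X n (C h)" for n h
      by (induction n arbitrary: h) (simp_all add: bop_simps[OF C] comm)
    then have "C (Y h) = Y (C h)"
      using LIMSEQ_unique[OF bop_tendsto[OF C Y[of h]]] Y[of "C h"] by simp
    then show ?thesis by (simp add: bop_simps[OF C])
  qed
  ultimately show ?thesis by (intro exI[of _ ?S]) blast
qed

end

text \<open>Over the complex numbers a real quadratic form forces symmetry, by polarization.\<close>

lemma positive_op_sym:
  assumes S: "bop S" "positive_op S"
  shows "cinner (S x) y = cinner x (S y)"
proof -
  have im: "Im (cinner (S z) z) = 0" for z
    using S(2) unfolding positive_op_def by (metis Im_complex_of_real)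
  have 1: "Im (cinner (S x) y) + Im (cinner (S y) x) = 0"
    using im[of "x + y"] im[of x] im[of y] by (simp add: bop_simps[OF S(1)] cinner_simps)
  have 2: "Re (cinner (S x) y) - Re (cinner (S y) x) = 0"
    using im[of "x + scaleC \<i> y"] im[of x] im[of y] by (simp add: bop_simps[OF S(1)] cinner_simps)
  have "cinner (S x) y = cnj (cinner (S y) x)"
    using 1 2 by (simp add: complex_eq_iff)
  then show ?thesis by (simp add: cinner_commute[of x])
qed

text \<open>If \<open>S y\<close> were nonzero, the form of \<open>S\<close> at
  \<open>y - r S y\<close> would have a negative linear term in \<open>r\<close> and no constant
  term, so it would be negative for small positive \<open>r\<close>.\<close>

lemma positive_op_null:
  assumes S: "bop S" "positive_op S" and 0: "cinner (S y) y = 0"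
  shows "S y = 0"
proof -
  define b where "b = Re (cinner (S (S y)) (S y))"
  define a where "a = (norm (S y))\<^sup>2"
  have pos: "0 \<le> Re (cinner (S z) z)" for z
    using S(2) by (simp add: positive_op_def)
  have b: "0 \<le> b" unfolding b_def by (rule pos)
  have "0 \<le> - 2 * r * a + r\<^sup>2 * b" for r
  proof -
    have e: "cinner (S (S y)) y = cinner (S y) (S y)"
      by (simp add: positive_op_sym[OF S])
    have "Re (cinner (S (y - r *\<^sub>R S y)) (y - r *\<^sub>R S y)) = - 2 * r * a + r\<^sup>2 * b"
      by (simp add: bop_simps[OF S(1)] cinner_simps 0 e a_def b_def power2_eq_square algebra_simps)
    then show ?thesis using pos[of "y - r *\<^sub>R S y"] by simp
  qed
  \<comment> \<open>\<open>b + 1\<close> stands in for the minimizing denominator \<open>b\<close>,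
    which may be 0; after clearing denominators the value is \<open>- a^2 (b + 2)\<close>.\<close>
  from this[of "a / (b + 1)"] have "0 \<le> (- 2 * (a / (b + 1)) * a + (a / (b + 1))\<^sup>2 * b) * (b + 1)\<^sup>2"
    by simp
  also have "\<dots> = - (a\<^sup>2 * (b + 2))"
  proof -
    define c where "c = a / (b + 1)"
    have "c * (b + 1) = a" using b by (simp add: c_def)
    moreover have "(- 2 * c * (c * (b + 1)) + c\<^sup>2 * b) * (b + 1)\<^sup>2 = - ((c * (b + 1))\<^sup>2 * (b + 2))"
      by (simp add: power2_eq_square algebra_simps)
    ultimately have "(- 2 * c * a + c\<^sup>2 * b) * (b + 1)\<^sup>2 = - (a\<^sup>2 * (b + 2))"
      by (simp only:)
    then show ?thesis by (simp only: c_def)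
  qed
  finally have "a\<^sup>2 * (b + 2) \<le> 0" by simp
  then have "a = 0"
    using b by (simp add: mult_le_0_iff)
  then show ?thesis by (simp add: a_def)
qed

text \<open>By commutation, \<open>S + T\<close> annihilates \<open>y = S h - T h\<close>. Both
  forms are nonnegative and so vanish at \<open>y\<close>, hence \<open>S y = T y = 0\<close>, and
  symmetry makes \<open>y\<close> orthogonal to itself.\<close>

lemma positive_sqrt_unique:
  assumes S: "bop S" "positive_op S" and T: "bop T" "positive_op T"
    and eq: "\<And>h. S (S h) = T (T h)" and comm: "\<And>h. T (S h) = S (T h)"
  shows "S = T"
proof
  fix h
  define y where "y = S h - T h"
  have "S y + T y = 0"
    by (simp add: y_def bop_simps[OF S(1)] bop_simps[OF T(1)] eq comm)
  then have "cinner (S y) y + cinner (T y) y = 0"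
    by (metis cinner_add_left cinner_zero_left)
  then have "Re (cinner (S y) y) + Re (cinner (T y) y) = 0"
    by (metis plus_complex.simps(1) zero_complex.simps(1))
  then have "Re (cinner (S y) y) = 0" "Re (cinner (T y) y) = 0"
    using S(2) T(2) unfolding positive_op_def by (smt (verit))+
  then have "cinner (S y) y = 0" "cinner (T y) y = 0"
    using S(2) T(2) unfolding positive_op_def by (metis of_real_0)+
  then have "S y = 0" "T y = 0"
    using positive_op_null S T by blast+
  then have "cinner (S h - T h) y = 0"
    by (simp add: cinner_diff_left positive_op_sym[OF S] positive_op_sym[OF T])
  then have "y = 0" by (simp add: cinner_eq_zero_iff y_def)
  then show "S h = T h" by (simp add: y_def)
qed

context
  fixes N :: "'a::chilbert \<Rightarrow> 'b::chilbert"
  assumes N: "contraction N"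
begin

lemma defect_sqrt:
  "bop (defect N) \<and> positive_op (defect N) \<and> (\<forall>h. defect N (defect N h) = h - adj N (N h))"
proof -
  note Nb = contraction_bop[OF N]
  let ?X = "\<lambda>h. adj N (N h)"
  have X: "bop ?X" by (rule bop_compose[OF bop_adj[OF Nb] Nb])
  have "norm (?X h) \<le> norm h" for h
    using contraction_adj_norm[OF N, of "N h"] N unfolding contraction_def
    by (meson order_trans)
  then have "contraction ?X" using X by (simp add: contraction_def bop_clinear)
  moreover have "cinner (?X x) y = cinner x (?X y)" for x y
    by (simp add: cinner_adj[OF Nb, symmetric] cinner_adj'[OF Nb, symmetric])
  ultimately obtain S where S: "bop S" "positive_op S" "\<And>h. S (S h) = h - ?X h"
      and comm: "\<And>C h. bop C \<Longrightarrow> (\<And>h. C (?X h) = ?X (C h)) \<Longrightarrow> C (S h) = S (C h)"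
    using sqrt_exists[of ?X] by metis
  have "defect N = S"
    unfolding defect_def op_sqrt_def
  proof (rule the_equality)
    show "bop S \<and> positive_op S \<and> (\<forall>x. S (S x) = x - adj N (N x))" using S by blast
  next
    fix T assume T: "bop T \<and> positive_op T \<and> (\<forall>x. T (T x) = x - adj N (N x))"
    \<comment> \<open>A competing root commutes with its own square \<open>1 - ?X\<close>, hence
      with \<open>?X\<close>, hence with \<open>S\<close> by the commutation clause.\<close>
    have "T (?X h) = ?X (T h)" for h
    proof -
      have "T (?X h) = T (h - T (T h))" using T by simp
      also have "\<dots> = T h - T (T (T h))" using T by (simp only: bop_simps)
      also have "T (T (T h)) = T h - ?X (T h)" using T by blast
      also have "T h - \<dots> = ?X (T h)" by simp
      finally show ?thesis .
    qed
    then have "T (S h) = S (T h)" for h using T comm by blast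
    then show "T = S"
      using positive_sqrt_unique[of S T] S T by metis
  qed
  then show ?thesis using S by simp
qed

lemma defect_bop: "bop (defect N)"
  using defect_sqrt by blast

lemma defect_sym: "cinner (defect N x) y = cinner x (defect N y)"
  using defect_sqrt positive_op_sym by blast

lemma cinner_defect: "cinner (defect N x) (defect N y) = cinner x y - cinner (N x) (N y)"
  using defect_sqrt by (simp add: defect_sym cinner_diff_right cinner_adj[OF contraction_bop[OF N]])

lemma norm_defect_sq: "(norm (defect N x))\<^sup>2 = (norm x)\<^sup>2 - (norm (N x))\<^sup>2"
proof -
  have "Re (cinner (defect N x) (defect N x)) = Re (cinner x x - cinner (N x) (N x))"
    by (simp only: cinner_defect)
  then show ?thesis by simp
qed

lemma defect_space_csubspace: "csubspace (defect_space N)"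
  unfolding defect_space_def
  by (intro csubspace_closure csubspace_range bop_clinear defect_bop)

lemma defect_space_closed: "closed (defect_space N)"
  by (simp add: defect_space_def)

lemma defect_in_defect_space: "defect N x \<in> defect_space N"
  unfolding defect_space_def by (rule subsetD[OF closure_subset]) simp

end

section \<open>Operators determined on a dense range\<close>

lemma cinner_zero_on_closure:
  assumes f: "bop f" and 0: "\<And>x. x \<in> S \<Longrightarrow> cinner (f x) y = 0" and x: "x \<in> closure S"
  shows "cinner (f x) y = 0"
proof -
  have "closed {x. cinner (f x) y = 0}"
    by (intro closed_Collect_eq cinner.continuous_on continuous_on_const bop_continuous f)
  then have "closure S \<subseteq> {x. cinner (f x) y = 0}"
    using 0 by (intro closure_minimal) auto
  then show ?thesis using x by blast
qed

text \<open>Polarization inside \<open>V\<close>; the restriction matters for \<open>E\<close>,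
  which is isometric on the defect space of \<open>T'\<close> and zero on its complement.\<close>

lemma isometric_cinner:
  assumes V: "csubspace V" and f: "bop f"
    and norm: "\<And>x. x \<in> V \<Longrightarrow> norm (f x) = norm x" and xy: "x \<in> V" "y \<in> V"
  shows "cinner (f x) (f y) = cinner x y"
proof -
  have Re: "Re (cinner (f x) (f z)) = Re (cinner x z)" if "z \<in> V" for z
  proof -
    have "x + z \<in> V" using V xy that by (simp add: csubspace_def)
    then have "(norm (f x + f z))\<^sup>2 = (norm (x + z))\<^sup>2"
      using norm by (simp add: bop_simps(1)[OF f, symmetric])
    then show ?thesis using norm that xy by (simp add: norm_add_sq)
  qed
  have "scaleC \<i> y \<in> V" using V xy by (simp add: csubspace_def)
  from Re[OF this] Re[OF xy(2)] show ?thesis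
    by (simp add: bop_simps(2)[OF f] cinner_scaleC_right complex_eq_iff)
qed

lemma isometry_cinner:
  assumes f: "isometry f"
  shows "cinner (f x) (f y) = cinner x y"
proof (rule isometric_cinner)
  show "bop f" by (rule contraction_bop[OF isometry_contraction[OF f]])
  show "csubspace UNIV" by (simp add: csubspace_def)
qed (use f in \<open>simp_all add: isometry_def\<close>)

lemma cinner_proj:
  fixes V :: "'a::chilbert set"
  assumes V: "csubspace V" "closed V"
  shows "cinner (proj V x) y = cinner x (proj V y)"
proof -
  have "cinner (proj V x) (y - proj V y) = 0" "cinner (x - proj V x) (proj V y) = 0"
    using proj_orth'[OF V] proj_orth[OF V] proj_in[OF V] by blast+
  then show ?thesis by (simp add: cinner_diff_left cinner_diff_right)
qed

text \<open>Since \<open>f\<close> factors through the self-adjoint projection onto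
  \<open>V\<close>, its adjoint is unchanged when followed by that projection.\<close>

lemma adj_in_subspace:
  fixes f :: "'a::chilbert \<Rightarrow> 'b::chilbert"
  assumes V: "csubspace V" "closed V" and f: "bop f" "\<And>h. f h = f (proj V h)"
  shows "adj f y \<in> V"
proof -
  have "cinner z (proj V (adj f y)) = cinner z (adj f y)" for z
    by (metis cinner_adj[OF f(1)] cinner_proj[OF V] f(2))
  then have "proj V (adj f y) = adj f y" by (rule cinner_right_cancel)
  then show ?thesis using proj_in[OF V] by metis
qed

text \<open>The value at a limit of \<open>S x\<^sub>n\<close> is the limit of \<open>W x\<^sub>n\<close>.\<close>

lemma dense_extension_exists:
  fixes S :: "'x::complex_inner \<Rightarrow> 'a::chilbert" and W :: "'x \<Rightarrow> 'b::chilbert"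
  assumes S: "bop S" and W: "clinear W" and bound: "\<And>x. norm (W x) \<le> K * norm (S x)"
  defines "V \<equiv> closure (range S)"
  shows "\<exists>w. bop w \<and> (\<forall>h. w h = w (proj V h)) \<and> (\<forall>x. w (S x) = W x)"
proof -
  have Sl: "clinear S" using S by (rule bop_clinear)
  have V: "csubspace V" "closed V"
    by (simp_all add: V_def csubspace_closure csubspace_range Sl)
  have approx: "\<exists>x. (\<lambda>n. S (x n)) \<longlonglongrightarrow> v" if "v \<in> V" for v
  proof -
    have "\<exists>u. (\<forall>n. u n \<in> range S) \<and> u \<longlonglongrightarrow> v"
      using that unfolding V_def closure_sequential .
    then obtain u where u: "\<And>n. u n \<in> range S" "u \<longlonglongrightarrow> v" by blast
    have "\<forall>n. \<exists>x. u n = S x" using u(1) by blast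
    then obtain x where "\<And>n. u n = S (x n)" by (rule choice[THEN exE]) blast
    then have "u = (\<lambda>n. S (x n))" by (rule ext)
    with u(2) show ?thesis by blast
  qed
  have "\<exists>l. \<forall>x. (\<lambda>n. S (x n)) \<longlonglongrightarrow> v \<longrightarrow> (\<lambda>n. W (x n)) \<longlonglongrightarrow> l" if "v \<in> V" for v
  proof -
    obtain x0 where x0: "(\<lambda>n. S (x0 n)) \<longlonglongrightarrow> v" using approx[OF \<open>v \<in> V\<close>] by blast
    \<comment> \<open>The constant is made strictly positive so that the Cauchy estimate can divide
      by it.\<close>
    have K: "norm (W x) \<le> (\<bar>K\<bar> + 1) * norm (S x)" for x
      by (rule order_trans[OF bound mult_right_mono]) auto
    have "Cauchy (\<lambda>n. W (x0 n))"
    proof (rule metric_CauchyI)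
      fix e :: real assume e: "0 < e"
      then have "0 < e / (\<bar>K\<bar> + 1)" by (simp add: add_nonneg_pos)
      then obtain M where M: "\<And>m n. m \<ge> M \<Longrightarrow> n \<ge> M \<Longrightarrow> norm (S (x0 m) - S (x0 n)) < e / (\<bar>K\<bar> + 1)"
        using CauchyD[OF LIMSEQ_imp_Cauchy[OF x0]] by meson
      have "dist (W (x0 m)) (W (x0 n)) < e" if "m \<ge> M" "n \<ge> M" for m n
      proof -
        have "norm (W (x0 m) - W (x0 n)) \<le> (\<bar>K\<bar> + 1) * norm (S (x0 m) - S (x0 n))"
          using K[of "x0 m - x0 n"] by (simp only: clinear_simps[OF W] clinear_simps[OF Sl])
        also have "\<dots> < e"
          using M[OF that] by (simp add: pos_less_divide_eq mult.commute add_nonneg_pos)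
        finally show ?thesis by (simp add: dist_norm)
      qed
      then show "\<exists>M. \<forall>m\<ge>M. \<forall>n\<ge>M. dist (W (x0 m)) (W (x0 n)) < e" by blast
    qed
    then obtain l where l: "(\<lambda>n. W (x0 n)) \<longlonglongrightarrow> l"
      using Cauchy_convergent convergent_def by blast
    have "(\<lambda>n. W (x n)) \<longlonglongrightarrow> l" if x: "(\<lambda>n. S (x n)) \<longlonglongrightarrow> v" for x
    proof (rule Lim_transform[OF l])
      have "(\<lambda>n. K * norm (S (x n) - S (x0 n))) \<longlonglongrightarrow> K * norm (v - v)"
        by (intro tendsto_intros x x0)
      then have lim: "(\<lambda>n. K * norm (S (x n) - S (x0 n))) \<longlonglongrightarrow> 0" by simp
      have "norm (W (x n) - W (x0 n)) \<le> K * norm (S (x n) - S (x0 n))" for n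
        using bound[of "x n - x0 n"] by (simp only: clinear_simps[OF W] clinear_simps[OF Sl])
      then show "(\<lambda>n. W (x n) - W (x0 n)) \<longlonglongrightarrow> 0"
        by (intro Lim_null_comparison[OF _ lim] always_eventually allI)
    qed
    then show ?thesis by blast
  qed
  then have "\<forall>v\<in>V. \<exists>l. \<forall>x. (\<lambda>n. S (x n)) \<longlonglongrightarrow> v \<longrightarrow> (\<lambda>n. W (x n)) \<longlonglongrightarrow> l"
    by (rule ballI)
  then obtain w where "\<forall>v\<in>V. \<forall>x. (\<lambda>n. S (x n)) \<longlonglongrightarrow> v \<longrightarrow> (\<lambda>n. W (x n)) \<longlonglongrightarrow> w v"
    by (rule bchoice[THEN exE])
  then have w: "\<And>v x. v \<in> V \<Longrightarrow> (\<lambda>n. S (x n)) \<longlonglongrightarrow> v \<Longrightarrow> (\<lambda>n. W (x n)) \<longlonglongrightarrow> w v"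
    by blast
  have add: "w (a + b) = w a + w b" if ab: "a \<in> V" "b \<in> V" for a b
  proof -
    obtain x y where x: "(\<lambda>n. S (x n)) \<longlonglongrightarrow> a" and y: "(\<lambda>n. S (y n)) \<longlonglongrightarrow> b"
      using approx[OF ab(1)] approx[OF ab(2)] by blast
    have "a + b \<in> V" using V ab by (simp add: csubspace_def)
    moreover have "(\<lambda>n. S (x n + y n)) \<longlonglongrightarrow> a + b"
      by (simp add: clinear_simps[OF Sl] tendsto_add x y)
    ultimately have "(\<lambda>n. W (x n + y n)) \<longlonglongrightarrow> w (a + b)" by (rule w)
    moreover have "(\<lambda>n. W (x n + y n)) \<longlonglongrightarrow> w a + w b"
      by (simp add: clinear_simps[OF W] tendsto_add w x y ab)
    ultimately show ?thesis by (rule LIMSEQ_unique)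
  qed
  have scale: "w (scaleC c a) = scaleC c (w a)" if a: "a \<in> V" for a c
  proof -
    obtain x where x: "(\<lambda>n. S (x n)) \<longlonglongrightarrow> a" using approx[OF a] by blast
    have "scaleC c a \<in> V" using V a by (simp add: csubspace_def)
    moreover have "(\<lambda>n. S (scaleC c (x n))) \<longlonglongrightarrow> scaleC c a"
      by (simp add: clinear_simps[OF Sl] bop_tendsto[OF bop_scaleC] x)
    ultimately have "(\<lambda>n. W (scaleC c (x n))) \<longlonglongrightarrow> w (scaleC c a)" by (rule w)
    moreover have "(\<lambda>n. W (scaleC c (x n))) \<longlonglongrightarrow> scaleC c (w a)"
      by (simp add: clinear_simps[OF W] bop_tendsto[OF bop_scaleC] w x a)
    ultimately show ?thesis by (rule LIMSEQ_unique)
  qed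
  have norm_w: "norm (w a) \<le> K * norm a" if a: "a \<in> V" for a
  proof -
    obtain x where x: "(\<lambda>n. S (x n)) \<longlonglongrightarrow> a" using approx[OF a] by blast
    show ?thesis
      by (rule LIMSEQ_le[OF tendsto_norm[OF w[OF a x]] tendsto_mult[OF tendsto_const tendsto_norm[OF x]]])
         (use bound in blast)
  qed
  \<comment> \<open>\<open>w\<close> is arbitrary off \<open>V\<close>; composing with the
    projection replaces it by the extension by zero on the orthogonal complement.\<close>
  let ?w = "\<lambda>h. w (proj V h)"
  have "bop ?w"
  proof (rule bopI[where K = "\<bar>K\<bar>"])
    show "clinear ?w"
      by (rule clinearI) (simp_all add: clinear_simps[OF proj_clinear[OF V]] add scale proj_in[OF V])
    fix h
    have "norm (?w h) \<le> K * norm (proj V h)" by (rule norm_w[OF proj_in[OF V]])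
    also have "\<dots> \<le> \<bar>K\<bar> * norm h" by (intro mult_mono proj_norm_le[OF V]) auto
    finally show "norm (?w h) \<le> \<bar>K\<bar> * norm h" .
  qed
  moreover have "?w (S x) = W x" for x
  proof -
    have "S x \<in> V" unfolding V_def by (rule subsetD[OF closure_subset]) simp
    then show ?thesis
      using w[of "S x" "\<lambda>_. x"] by (simp add: proj_fixed[OF V] LIMSEQ_const_iff)
  qed
  ultimately show ?thesis by (intro exI[of _ ?w]) (simp add: proj_idem[OF V])
qed

lemma dense_extension_unique:
  fixes S :: "'x::complex_inner \<Rightarrow> 'a::chilbert"
  assumes S: "bop S" and V: "V = closure (range S)"
    and w: "bop w" "\<And>h. w h = w (proj V h)" and w': "bop w'" "\<And>h. w' h = w' (proj V h)"
    and eq: "\<And>x. w (S x) = w' (S x)"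
  shows "w = w'"
proof
  fix h
  have "proj V h \<in> closure (range S)"
    using proj_in[of V] unfolding V by (simp add: csubspace_closure csubspace_range bop_clinear[OF S])
  then have "w (proj V h) = w' (proj V h)"
    using bop_eq_on_closure[OF w(1) w'(1), of "range S"] eq by blast
  then show "w h = w' h" using w(2) w'(2) by metis
qed

text \<open>Shaped to match the definite descriptions behind \<open>omega1\<close>,
  \<open>omega2\<close> and the isometric \<open>E\<close> of the lifting.\<close>

lemma dense_extension_the:
  fixes S :: "'x::complex_inner \<Rightarrow> 'a::chilbert" and W :: "'x \<Rightarrow> 'b::chilbert"
  assumes S: "bop S" and W: "clinear W" and bound: "\<And>x. norm (W x) \<le> K * norm (S x)"
    and V: "V = closure (range S)"
  defines "w \<equiv> THE w. bop w \<and> (\<forall>h. w h = w (proj V h)) \<and> (\<forall>x. w (S x) = W x)"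
  shows "bop w" "w h = w (proj V h)" "w (S x) = W x"
proof -
  have "\<exists>!w. bop w \<and> (\<forall>h. w h = w (proj V h)) \<and> (\<forall>x. w (S x) = W x)"
    using dense_extension_exists[OF S W bound] dense_extension_unique[OF S V] unfolding V by metis
  from theI'[OF this] show "bop w" "w h = w (proj V h)" "w (S x) = W x"
    unfolding w_def by blast+
qed

text \<open>If \<open>g \<bottom> V\<close> and \<open>x = M\<^sup>* (C g)\<close>, then \<open>C (s x + g) = (s + 1) C g\<close> while
  \<open>\<parallel>s x + g\<parallel>\<^sup>2 = s\<^sup>2 \<parallel>C g\<parallel>\<^sup>2 + \<parallel>g\<parallel>\<^sup>2\<close>; for large \<open>s\<close> this forces \<open>C g = 0\<close>.\<close>

lemma contraction_extending_coisometry: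
  fixes C M :: "'a::chilbert \<Rightarrow> 'b::chilbert"
  assumes V: "csubspace V" "closed V"
    and C: "contraction C" "\<And>h. C h \<in> W"
    and M: "bop M" "\<And>h. M h = M (proj V h)" "\<And>y. y \<in> W \<Longrightarrow> M (adj M y) = y"
    and ext: "\<And>f. f \<in> V \<Longrightarrow> C f = M f"
  shows "C h = M h"
proof -
  have Cb: "bop C" by (rule contraction_bop[OF C(1)])
  define g where "g = h - proj V h"
  define y where "y = C g"
  define x where "x = adj M y"
  have xV: "x \<in> V" unfolding x_def by (rule adj_in_subspace[OF V M(1,2)])
  have Cx: "C x = y" using ext[OF xV] M(3)[of y] C(2) by (simp add: x_def y_def)
  have xy: "(norm x)\<^sup>2 = (norm y)\<^sup>2"
  proof -
    have "cinner x x = cinner (M x) y" by (simp add: x_def cinner_adj[OF M(1)])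
    also have "M x = y" using Cx ext[OF xV] by simp
    finally have "Re (cinner x x) = Re (cinner y y)" by simp
    then show ?thesis by simp
  qed
  have ineq: "(s + 1)\<^sup>2 * (norm y)\<^sup>2 \<le> s\<^sup>2 * (norm y)\<^sup>2 + (norm g)\<^sup>2" for s :: real
  proof -
    have "C (s *\<^sub>R x + g) = (s + 1) *\<^sub>R y"
      by (simp add: bop_simps[OF Cb] Cx y_def[symmetric] algebra_simps)
    then have "(s + 1)\<^sup>2 * (norm y)\<^sup>2 = (norm (C (s *\<^sub>R x + g)))\<^sup>2"
      by (simp add: power_mult_distrib)
    also have "\<dots> \<le> (norm (s *\<^sub>R x + g))\<^sup>2"
      using C(1) by (simp add: contraction_def power_mono)
    also have "\<dots> = s\<^sup>2 * (norm y)\<^sup>2 + (norm g)\<^sup>2"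
    proof -
      have "cinner (s *\<^sub>R x) g = 0"
        using proj_orth'[OF V xV, of h] by (simp add: g_def cinner_scaleR_left)
      then show ?thesis by (simp add: pythagoras power_mult_distrib xy)
    qed
    finally show ?thesis .
  qed
  have "y = 0"
  proof (rule ccontr)
    assume "y \<noteq> 0"
    then have p: "0 < (norm y)\<^sup>2" by simp
    \<comment> \<open>With this \<open>s\<close> the inequality reads
      \<open>2 (norm g)^2 + (norm y)^2 \<le> (norm g)^2\<close>, which is absurd for nonzero
      \<open>y\<close>.\<close>
    define s where "s = (norm g)\<^sup>2 / (norm y)\<^sup>2"
    have "s * (norm y)\<^sup>2 = (norm g)\<^sup>2" using p by (simp add: s_def)
    moreover have "(2 * s + 1) * (norm y)\<^sup>2 \<le> (norm g)\<^sup>2"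
      using ineq[of s] by (simp add: power2_eq_square algebra_simps)
    ultimately have "(norm g)\<^sup>2 + (norm y)\<^sup>2 \<le> 0" by (simp add: algebra_simps)
    then show False using p zero_le_power2[of "norm g"] by linarith
  qed
  then have "C h = C (proj V h)" by (simp add: y_def g_def bop_simps[OF Cb])
  also have "\<dots> = M h" using ext[OF proj_in[OF V]] M(2) by metis
  finally show ?thesis .
qed

section \<open>The structure of contractive interpolants\<close>

locale relaxed_lifting =
  fixes A :: "'h::chilbert \<Rightarrow> 'g::chilbert" and T' :: "'g \<Rightarrow> 'g"
    and J :: "'g \<Rightarrow> 'k::chilbert" and U' :: "'k \<Rightarrow> 'k"
    and R Q :: "'z::chilbert \<Rightarrow> 'h"
  assumes data: "data_set A T' J U' R Q"
begin

abbreviation "F \<equiv> F_space A Q"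
abbreviation "DA \<equiv> defect_space A"
abbreviation "DT \<equiv> defect_space T'"
abbreviation "w1 \<equiv> omega1 A T' R Q"
abbreviation "w2 \<equiv> omega2 A R Q"

lemma A: "contraction A" and T': "contraction T'" and J: "isometry J" and U': "isometry U'"
  and R: "bop R" and Q: "bop Q" and intertwine: "T' (A (R x)) = A (Q x)"
  and lifting: "adj J (U' k) = T' (adj J k)"
  and cyclic: "closure (cspan (\<Union>n. range (\<lambda>h. (U' ^^ n) (J h)))) = UNIV"
  and RQ: "Re (cinner (adj R (R x)) x) \<le> Re (cinner (adj Q (Q x)) x)"
  using data by (simp_all add: data_set_def min_isometric_lifting_def)

lemma bops: "bop A" "bop T'" "bop J" "bop U'"
  using A T' J U' contraction_bop isometry_contraction by blast+

lemma norm_R_le: "norm (R x) \<le> norm (Q x)"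
proof -
  have "Re (cinner (R x) (R x)) \<le> Re (cinner (Q x) (Q x))"
    using RQ[of x] by (simp only: cinner_adj'[OF R] cinner_adj'[OF Q])
  then show ?thesis by (simp add: power2_le_iff_abs_le)
qed

lemma adj_J_J: "adj J (J x) = x"
  by (rule cinner_right_cancel) (simp add: cinner_adj[OF bops(3), symmetric] isometry_cinner[OF J])

lemmas DT_space = defect_space_csubspace[OF T'] defect_space_closed[OF T']
lemmas DA_space = defect_space_csubspace[OF A] defect_space_closed[OF A]

lemma F_bop: "bop (\<lambda>x. defect A (Q x))"
  by (rule bop_compose[OF defect_bop[OF A] Q])

lemma F_space: "csubspace F" "closed F"
  by (simp_all add: F_space_def csubspace_closure csubspace_range bop_clinear[OF F_bop])

lemma F_subset_DA: "F \<subseteq> DA"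
  unfolding F_space_def defect_space_def by (rule closure_mono) auto

lemma in_F: "defect A (Q x) \<in> F"
  unfolding F_space_def by (rule subsetD[OF closure_subset]) simp

text \<open>\<open>\<K>'\<close> is the orthogonal sum of \<open>J \<H>'\<close> and the subspaces \<open>U'\<^sup>n E \<D>\<^bsub>T'\<^esub>\<close>, where
  \<open>E\<close> is isometric on \<open>\<D>\<^bsub>T'\<^esub>\<close>.\<close>

definition E :: "'g \<Rightarrow> 'k" where
  "E = (THE w. bop w \<and> (\<forall>h. w h = w (proj DT h)) \<and> (\<forall>x. w (defect T' x) = U' (J x) - J (T' x)))"

text \<open>\<open>J (T' x)\<close> is the orthogonal projection of \<open>U' (J x)\<close> onto the
  range of \<open>J\<close>, so both squared norms equal
  \<open>(norm x)^2 - (norm (T' x))^2\<close>.\<close>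

lemma norm_lifting_defect: "norm (U' (J x) - J (T' x)) = norm (defect T' x)"
proof -
  have "cinner (U' (J x)) (J (T' x)) = cinner (T' x) (T' x)"
    by (simp add: cinner_adj'[OF bops(3)] lifting adj_J_J)
  then have "(norm (U' (J x) - J (T' x)))\<^sup>2 = (norm (defect T' x))\<^sup>2"
    using J U' by (simp add: norm_diff_sq norm_defect_sq[OF T'] isometry_def)
  then show ?thesis by (simp add: power2_eq_iff_nonneg)
qed

lemma E_bop: "bop E"
  and E_proj: "E h = E (proj DT h)"
  and E_defect: "E (defect T' x) = U' (J x) - J (T' x)"
proof -
  have "clinear (\<lambda>x. U' (J x) - J (T' x))"
    by (rule bop_clinear[OF bop_diff[OF bop_compose[OF bops(4,3)] bop_compose[OF bops(3,2)]]])
  note ext = dense_extension_the[OF defect_bop[OF T'] this, where K = 1 and V = DT, folded E_def]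
  show "bop E" "E h = E (proj DT h)" "E (defect T' x) = U' (J x) - J (T' x)"
    by (rule ext; simp add: norm_lifting_defect defect_space_def)+
qed

lemma norm_E: "d \<in> DT \<Longrightarrow> norm (E d) = norm d"
proof -
  assume d: "d \<in> DT"
  have "closed {d. norm (E d) = norm d}"
    by (intro closed_Collect_eq continuous_on_norm bop_continuous E_bop continuous_on_id)
  then have "DT \<subseteq> {d. norm (E d) = norm d}"
    unfolding defect_space_def
    by (intro closure_minimal) (auto simp: E_defect norm_lifting_defect)
  then show ?thesis using d by blast
qed

lemma norm_E_le: "norm (E d) \<le> norm d"
  using norm_E[OF proj_in[OF DT_space], of d] proj_norm_le[OF DT_space, of d] E_proj[of d] by simp

lemma adj_J_E: "adj J (E d) = 0"
proof -
  have "adj J (E (proj DT d)) = 0"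
  proof (rule bop_eq_on_closure[where f = "\<lambda>d. adj J (E d)" and g = "\<lambda>d. 0" and S = "range (defect T')"])
    show "bop (\<lambda>d. adj J (E d))" by (rule bop_compose[OF bop_adj[OF bops(3)] E_bop])
    show "bop (\<lambda>d::'g. 0::'g)" using bop_diff[OF bop_id bop_id] by simp
    show "proj DT d \<in> closure (range (defect T'))"
      using proj_in[OF DT_space] by (simp add: defect_space_def)
    fix x assume "x \<in> range (defect T')"
    then show "adj J (E x) = 0"
      by (auto simp: E_defect bop_simps[OF bop_adj[OF bops(3)]] lifting adj_J_J)
  qed
  then show ?thesis by (simp add: E_proj[of d, symmetric])
qed

text \<open>Source of all orthogonality between the summands: vectors orthogonal to the range of
  \<open>J\<close> are mapped by \<open>U'\<close> to vectors orthogonal to the range of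
  \<open>E\<close> as well.\<close>

lemma E_orth_U': "adj J k = 0 \<Longrightarrow> cinner (E d) (U' k) = 0"
proof -
  assume k: "adj J k = 0"
  have "cinner (E (proj DT d)) (U' k) = 0"
  proof (rule cinner_zero_on_closure[OF E_bop])
    show "proj DT d \<in> closure (range (defect T'))"
      using proj_in[OF DT_space] by (simp add: defect_space_def)
    fix x assume "x \<in> range (defect T')"
    then show "cinner (E x) (U' k) = 0"
      by (auto simp: E_defect cinner_diff_left isometry_cinner[OF U'] cinner_adj[OF bops(3)]
          lifting k bop_simps[OF bops(2)])
  qed
  then show ?thesis by (simp add: E_proj[of d, symmetric])
qed

definition wander :: "nat \<Rightarrow> 'g \<Rightarrow> 'k" where
  "wander n d = (U' ^^ n) (E d)"

lemma wander_0: "wander 0 d = E d" and wander_Suc: "wander (Suc n) d = U' (wander n d)"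
  by (simp_all add: wander_def)

lemma wander_contraction: "contraction (wander n)"
proof -
  have "clinear (wander n)"
    unfolding wander_def by (rule bop_clinear[OF bop_compose[OF bop_funpow[OF bops(4)] E_bop]])
  moreover have "norm (wander n d) \<le> norm d" for d
    by (induction n) (use U' in \<open>simp_all add: wander_0 wander_Suc norm_E_le isometry_def\<close>)
  ultimately show ?thesis by (simp add: contraction_def)
qed

lemmas wander_bop = contraction_bop[OF wander_contraction]

lemma wander_proj: "wander n d = wander n (proj DT d)"
  unfolding wander_def using E_proj[of d] by simp

lemma adj_J_wander: "adj J (wander n d) = 0"
  by (induction n) (simp_all add: wander_0 wander_Suc adj_J_E lifting bop_simps[OF bops(2)])

text \<open>Minimality of the lifting enters here. Iterating
  \<open>U' (J h) = J (T' h) + E (defect T' h)\<close> writes every \<open>(U' ^^ n) (J h)\<close>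
  through the range of \<open>J\<close> and the ranges of \<open>wander\<close>, and these orbits
  span densely.\<close>

lemma orth_all_zero:
  assumes k: "adj J k = 0" "\<And>n. adj (wander n) k = 0"
  shows "k = 0"
proof -
  have 0: "cinner ((U' ^^ n) (J h)) k = 0" for n h
  proof (induction n arbitrary: h)
    case 0
    then show ?case by (simp add: cinner_adj[OF bops(3)] k)
  next
    case (Suc n)
    have "(U' ^^ Suc n) (J h) = (U' ^^ n) (U' (J h))" by (simp only: funpow_Suc_right comp_def)
    also have "U' (J h) = J (T' h) + E (defect T' h)" by (simp add: E_defect)
    also have "(U' ^^ n) \<dots> = (U' ^^ n) (J (T' h)) + wander n (defect T' h)"
      by (simp add: bop_simps[OF bop_funpow[OF bops(4)]] wander_def)
    finally show ?case
      by (simp add: cinner_add_left Suc cinner_adj[OF wander_bop] k)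
  qed
  have "cinner x k = 0" if "x \<in> cspan (\<Union>n. range (\<lambda>h. (U' ^^ n) (J h)))" for x
  proof -
    obtain S c where S: "S \<subseteq> (\<Union>n. range (\<lambda>h. (U' ^^ n) (J h)))" "x = (\<Sum>v\<in>S. scaleC (c v) v)"
      using \<open>x \<in> cspan _\<close> unfolding cspan_def by blast
    have "cinner v k = 0" if "v \<in> S" for v using S(1) that 0 by blast
    then show ?thesis
      unfolding S(2) by (simp add: cinner.sum_left cinner_scaleC_left)
  qed
  then have "cinner k k = 0"
    using cinner_zero_on_closure[OF bop_id, of _ k k] cyclic by blast
  then show ?thesis by (simp add: cinner_eq_zero_iff)
qed

lemma adj_wander_in_DT: "adj (wander n) k \<in> DT"
  by (rule adj_in_subspace[OF DT_space wander_bop wander_proj])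

text \<open>The two summands are orthogonal and \<open>E\<close>, \<open>U'\<close> preserve inner
  products, so the coefficients form the sequence of \<open>k\<close> shifted by one place with
  \<open>a\<close> put in front. This turns \<open>G = E w1 + U' G w2\<close> into a recursion for
  coefficients.\<close>

lemma adj_wander_step:
  assumes a: "a \<in> DT" and k: "adj J k = 0"
  shows "adj (wander 0) (E a + U' k) = a"
    and "adj (wander (Suc n)) (E a + U' k) = adj (wander n) k"
proof -
  show "adj (wander 0) (E a + U' k) = a"
  proof (rule cinner_right_cancel)
    fix d
    have "cinner d (adj (wander 0) (E a + U' k)) = cinner (E d) (E a)"
      by (simp add: cinner_adj[OF wander_bop, symmetric] wander_0 cinner_add_right E_orth_U'[OF k])
    also have "\<dots> = cinner (E (proj DT d)) (E a)" by (simp add: E_proj[of d, symmetric])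
    also have "\<dots> = cinner (proj DT d) a"
      by (rule isometric_cinner[OF DT_space(1) E_bop norm_E proj_in[OF DT_space] a])
    also have "\<dots> = cinner d a" by (simp add: cinner_proj[OF DT_space] proj_fixed[OF DT_space a])
    finally show "cinner d (adj (wander 0) (E a + U' k)) = cinner d a" .
  qed
  show "adj (wander (Suc n)) (E a + U' k) = adj (wander n) k"
  proof (rule cinner_right_cancel)
    fix d
    have "cinner (U' (wander n d)) (E a) = 0"
      using E_orth_U'[OF adj_J_wander] cinner_eq_0_commute by blast
    then show "cinner d (adj (wander (Suc n)) (E a + U' k)) = cinner d (adj (wander n) k)"
      by (simp add: cinner_adj[OF wander_bop, symmetric] wander_Suc cinner_add_right
          isometry_cinner[OF U'])
  qed
qed

text \<open>By the intertwining relation the left side telescopes to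
  \<open>(norm (R x))^2 - (norm (A (Q x)))^2\<close>.\<close>

lemma omega_bound:
  "(norm (defect T' (A (R x))))\<^sup>2 + (norm (defect A (R x)))\<^sup>2 \<le> (norm (defect A (Q x)))\<^sup>2"
  using power_mono[OF norm_R_le[of x], of 2]
  by (simp add: norm_defect_sq[OF A] norm_defect_sq[OF T'] intertwine)

lemma w1_bop: "bop w1" and w1_proj: "w1 h = w1 (proj F h)"
  and w1_defect: "w1 (defect A (Q x)) = defect T' (A (R x))"
proof -
  have lin: "clinear (\<lambda>x. defect T' (A (R x)))"
    by (rule bop_clinear[OF bop_compose[OF defect_bop[OF T'] bop_compose[OF bops(1) R]]])
  have "norm (defect T' (A (R x))) \<le> 1 * norm (defect A (Q x))" for x
  proof -
    have "(norm (defect T' (A (R x))))\<^sup>2 \<le> (norm (defect A (Q x)))\<^sup>2"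
      using omega_bound[of x] zero_le_power2[of "norm (defect A (R x))"] by linarith
    from power2_le_imp_le[OF this] show ?thesis by simp
  qed
  note ext = dense_extension_the[OF F_bop lin this, where V = F, folded omega1_def]
  show "bop w1" "w1 h = w1 (proj F h)" "w1 (defect A (Q x)) = defect T' (A (R x))"
    by (rule ext; simp add: F_space_def)+
qed

lemma w2_bop: "bop w2" and w2_proj: "w2 h = w2 (proj F h)"
  and w2_defect: "w2 (defect A (Q x)) = defect A (R x)"
proof -
  have lin: "clinear (\<lambda>x. defect A (R x))"
    by (rule bop_clinear[OF bop_compose[OF defect_bop[OF A] R]])
  have "norm (defect A (R x)) \<le> 1 * norm (defect A (Q x))" for x
  proof -
    have "(norm (defect A (R x)))\<^sup>2 \<le> (norm (defect A (Q x)))\<^sup>2"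
      using omega_bound[of x] zero_le_power2[of "norm (defect T' (A (R x)))"] by linarith
    from power2_le_imp_le[OF this] show ?thesis by simp
  qed
  note ext = dense_extension_the[OF F_bop lin this, where V = F, folded omega2_def]
  show "bop w2" "w2 h = w2 (proj F h)" "w2 (defect A (Q x)) = defect A (R x)"
    by (rule ext; simp add: F_space_def)+
qed

lemma w1_in_DT: "w1 h \<in> DT"
proof -
  have "closed {h. w1 h \<in> DT}"
    using closed_vimage[OF DT_space(2) bop_continuous[OF w1_bop]] by (simp add: vimage_def)
  then have "F \<subseteq> {h. w1 h \<in> DT}"
    unfolding F_space_def
    by (intro closure_minimal) (auto simp: w1_defect defect_in_defect_space[OF T'])
  then show ?thesis using w1_proj[of h] proj_in[OF F_space, of h] by auto
qed

lemma w2_in_DA: "w2 h \<in> DA"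
proof -
  have "closed {h. w2 h \<in> DA}"
    using closed_vimage[OF DA_space(2) bop_continuous[OF w2_bop]] by (simp add: vimage_def)
  then have "F \<subseteq> {h. w2 h \<in> DA}"
    unfolding F_space_def
    by (intro closure_minimal) (auto simp: w2_defect defect_in_defect_space[OF A])
  then show ?thesis using w2_proj[of h] proj_in[OF F_space, of h] by auto
qed

lemma omega_contraction: "(norm (w1 h))\<^sup>2 + (norm (w2 h))\<^sup>2 \<le> (norm h)\<^sup>2"
proof -
  have "closed {h. (norm (w1 h))\<^sup>2 + (norm (w2 h))\<^sup>2 \<le> (norm h)\<^sup>2}"
    by (intro closed_Collect_le continuous_intros bop_continuous w1_bop w2_bop)
  then have "F \<subseteq> {h. (norm (w1 h))\<^sup>2 + (norm (w2 h))\<^sup>2 \<le> (norm h)\<^sup>2}"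
    unfolding F_space_def
    by (intro closure_minimal) (auto simp: w1_defect w2_defect omega_bound)
  then have "(norm (w1 (proj F h)))\<^sup>2 + (norm (w2 (proj F h)))\<^sup>2 \<le> (norm (proj F h))\<^sup>2"
    using proj_in[OF F_space, of h] by blast
  also have "\<dots> \<le> (norm h)\<^sup>2" by (intro power_mono proj_norm_le[OF F_space]) simp
  finally show ?thesis by (simp add: w1_proj[of h, symmetric] w2_proj[of h, symmetric])
qed

section \<open>Interpolants as contractions of the defect space of \<open>A\<close>\<close>

definition represents :: "('h \<Rightarrow> 'k) \<Rightarrow> ('h \<Rightarrow> 'k) \<Rightarrow> bool" where
  "represents G B \<longleftrightarrow> contraction G \<and> (\<forall>h. adj J (G h) = 0) \<and> (\<forall>h. B h = J (A h) + G (defect A h))"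

lemma represents_bop: "represents G B \<Longrightarrow> bop G"
  by (simp add: represents_def contraction_bop)

text \<open>\<open>J (A h)\<close> is the projection of \<open>B h\<close> onto the range of
  \<open>J\<close>, so the remainder has squared norm
  \<open>(norm (B h))^2 - (norm (A h))^2\<close>, at most that of \<open>defect A h\<close>, and
  therefore factors contractively through \<open>defect A\<close>.\<close>

lemma interpolant_represented:
  assumes B: "contractive_interpolant A J U' R Q B"
  shows "\<exists>G. represents G B"
proof -
  have Bc: "contraction B" and JB: "\<And>h. adj J (B h) = A h"
    using B by (simp_all add: contractive_interpolant_def)
  let ?W = "\<lambda>h. B h - J (A h)"
  have lin: "clinear ?W"
    by (rule bop_clinear[OF bop_diff[OF contraction_bop[OF Bc] bop_compose[OF bops(3,1)]]])
  have bound: "norm (?W h) \<le> 1 * norm (defect A h)" for h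
  proof -
    have "(norm (?W h))\<^sup>2 = (norm (B h))\<^sup>2 - (norm (A h))\<^sup>2"
      using J by (simp add: norm_diff_sq cinner_adj'[OF bops(3)] JB isometry_def)
    also have "\<dots> \<le> (norm (defect A h))\<^sup>2"
      using Bc power_mono[of "norm (B h)" "norm h" 2]
      by (simp add: norm_defect_sq[OF A] contraction_def)
    finally have "(norm (?W h))\<^sup>2 \<le> (norm (defect A h))\<^sup>2" .
    from power2_le_imp_le[OF this] show ?thesis by simp
  qed
  obtain G where G: "bop G" "\<And>h. G h = G (proj DA h)" "\<And>h. G (defect A h) = ?W h"
    using dense_extension_exists[OF defect_bop[OF A] lin bound] unfolding defect_space_def by metis
  have "norm (G h) \<le> norm h" for h
  proof -
    have "closed {h. norm (G h) \<le> norm h}"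
      by (intro closed_Collect_le continuous_intros bop_continuous G)
    then have "DA \<subseteq> {h. norm (G h) \<le> norm h}"
      unfolding defect_space_def using bound by (intro closure_minimal) (auto simp: G(3))
    then have "norm (G (proj DA h)) \<le> norm (proj DA h)"
      using proj_in[OF DA_space, of h] by blast
    then show ?thesis using proj_norm_le[OF DA_space, of h] G(2)[of h] by simp
  qed
  moreover have "adj J (G h) = 0" for h
  proof -
    have "adj J (G (proj DA h)) = 0"
    proof (rule bop_eq_on_closure[where f = "\<lambda>h. adj J (G h)" and g = "\<lambda>h. 0" and S = "range (defect A)"])
      show "bop (\<lambda>h. adj J (G h))" by (rule bop_compose[OF bop_adj[OF bops(3)] G(1)])
      show "bop (\<lambda>h::'h. 0::'g)" using bop_diff[OF bops(1) bops(1)] by simp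
      show "proj DA h \<in> closure (range (defect A))"
        using proj_in[OF DA_space] by (simp add: defect_space_def)
      fix x assume "x \<in> range (defect A)"
      then show "adj J (G x) = 0"
        by (auto simp: G(3) bop_simps[OF bop_adj[OF bops(3)]] JB adj_J_J)
    qed
    then show ?thesis by (simp add: G(2)[of h, symmetric])
  qed
  ultimately have "represents G B"
    using G by (simp add: represents_def contraction_def bop_clinear)
  then show ?thesis by blast
qed

text \<open>On the dense vectors \<open>defect A (Q x)\<close> this is the equation
  \<open>U' B R = B Q\<close>, after splitting \<open>U' J A R x\<close> into \<open>J A Q x\<close>
  and an \<open>E\<close> part.\<close>

lemma represented_recursion:
  assumes B: "contractive_interpolant A J U' R Q B" and G: "represents G B" and f: "f \<in> F"
  shows "G f = E (w1 f) + U' (G (w2 f))"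
proof (rule bop_eq_on_closure[where f = G and S = "range (\<lambda>x. defect A (Q x))"])
  have Gb: "bop G" by (rule represents_bop[OF G])
  show "bop G" by (rule Gb)
  show "bop (\<lambda>f. E (w1 f) + U' (G (w2 f)))"
    by (rule bop_add[OF bop_compose[OF E_bop w1_bop] bop_compose[OF bops(4) bop_compose[OF Gb w2_bop]]])
  show "f \<in> closure (range (\<lambda>x. defect A (Q x)))" using f by (simp add: F_space_def)
  fix y assume "y \<in> range (\<lambda>x. defect A (Q x))"
  then obtain x where y: "y = defect A (Q x)" by blast
  have "U' (B (R x)) = B (Q x)" using B by (simp add: contractive_interpolant_def)
  then have "U' (J (A (R x)) + G (defect A (R x))) = J (A (Q x)) + G (defect A (Q x))"
    using G by (simp add: represents_def)
  then show "G y = E (w1 y) + U' (G (w2 y))"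
    by (simp add: y w1_defect w2_defect E_defect bop_simps[OF bops(4)] intertwine algebra_simps)
qed

section \<open>Interpolants from contractive extensions of the underlying contraction\<close>

text \<open>Partial sums of the series with terms \<open>wander k (Z1 ((Z2 ^^ k) h))\<close>, peeled
  from the front so that the limit inherits the fixed-point equation.\<close>

primrec psum :: "('h \<Rightarrow> 'g) \<Rightarrow> ('h \<Rightarrow> 'h) \<Rightarrow> nat \<Rightarrow> 'h \<Rightarrow> 'k" where
  "psum Z1 Z2 0 h = 0"
| "psum Z1 Z2 (Suc n) h = E (Z1 h) + U' (psum Z1 Z2 n (Z2 h))"

context
  fixes Z1 :: "'h \<Rightarrow> 'g" and Z2 :: "'h \<Rightarrow> 'h"
  assumes Z: "bop Z1" "bop Z2" "\<And>h. Z1 h \<in> DT"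
    and Z_contr: "\<And>h. (norm (Z1 h))\<^sup>2 + (norm (Z2 h))\<^sup>2 \<le> (norm h)\<^sup>2"
begin

lemma psum_bop: "bop (psum Z1 Z2 n)"
proof (induction n)
  case 0
  have "psum Z1 Z2 0 = (\<lambda>h. 0)" by (simp add: fun_eq_iff)
  then show ?case by (simp add: bop_def clinear_def bop_simps[OF bop_scaleC] exI[of _ 0])
next
  case (Suc n)
  have "psum Z1 Z2 (Suc n) = (\<lambda>h. E (Z1 h) + U' (psum Z1 Z2 n (Z2 h)))"
    by (simp add: fun_eq_iff)
  then show ?case
    using bop_add[OF bop_compose[OF E_bop Z(1)] bop_compose[OF bops(4) bop_compose[OF Suc Z(2)]]]
    by metis
qed

lemma adj_J_psum: "adj J (psum Z1 Z2 n h) = 0"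
  by (induction n arbitrary: h)
    (simp_all add: bop_simps[OF bop_adj[OF bops(3)]] adj_J_E lifting bop_simps[OF bops(2)])

text \<open>The residual \<open>(Z2 ^^ n) h\<close> is carried along, so that contractivity of the
  pair can be spent once per term in a telescoping sum.\<close>

lemma psum_norm: "(norm (psum Z1 Z2 n h))\<^sup>2 + (norm ((Z2 ^^ n) h))\<^sup>2 \<le> (norm h)\<^sup>2"
proof (induction n arbitrary: h)
  case (Suc n)
  have "(norm (psum Z1 Z2 (Suc n) h))\<^sup>2 = (norm (Z1 h))\<^sup>2 + (norm (psum Z1 Z2 n (Z2 h)))\<^sup>2"
    using U' by (simp add: pythagoras E_orth_U' adj_J_psum norm_E[OF Z(3)] isometry_def)
  moreover have "(Z2 ^^ Suc n) h = (Z2 ^^ n) (Z2 h)" by (simp only: funpow_Suc_right comp_def)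
  ultimately show ?case
    using Suc[of "Z2 h"] Z_contr[of h] by simp
qed simp

text \<open>Each induction step strips one isometry \<open>U'\<close> off the tail, until a full
  partial sum at \<open>(Z2 ^^ m) h\<close> is left. The bound is a difference of a decreasing real
  sequence, hence Cauchy.\<close>

lemma psum_diff:
  "(norm (psum Z1 Z2 (m + j) h - psum Z1 Z2 m h))\<^sup>2 \<le> (norm ((Z2 ^^ m) h))\<^sup>2 - (norm ((Z2 ^^ (m + j)) h))\<^sup>2"
proof (induction m arbitrary: h)
  case 0
  then show ?case using psum_norm[of j h] by simp
next
  case (Suc m)
  have "psum Z1 Z2 (Suc m + j) h - psum Z1 Z2 (Suc m) h
      = U' (psum Z1 Z2 (m + j) (Z2 h) - psum Z1 Z2 m (Z2 h))"
    by (simp add: bop_simps[OF bops(4)])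
  then have "norm (psum Z1 Z2 (Suc m + j) h - psum Z1 Z2 (Suc m) h)
      = norm (psum Z1 Z2 (m + j) (Z2 h) - psum Z1 Z2 m (Z2 h))"
    using U' by (simp add: isometry_def)
  then show ?case
    using Suc[of "Z2 h"] by (simp only: funpow_Suc_right comp_def add_Suc)
qed

lemma psum_convergent: "convergent (\<lambda>n. psum Z1 Z2 n h)"
proof -
  define a where "a n = (norm ((Z2 ^^ n) h))\<^sup>2" for n
  have "a (Suc n) \<le> a n" for n
    using Z_contr[of "(Z2 ^^ n) h"] zero_le_power2[of "norm (Z1 ((Z2 ^^ n) h))"]
    unfolding a_def funpow.simps comp_def by linarith
  then have "decseq a" by (rule decseq_SucI)
  then obtain L where "a \<longlonglongrightarrow> L"
    using decseq_convergent[of a 0] by (auto simp: a_def)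
  then have a: "Cauchy a" by (rule LIMSEQ_imp_Cauchy)
  have "Cauchy (\<lambda>n. psum Z1 Z2 n h)"
  proof (rule CauchyI')
    fix e :: real assume e: "0 < e"
    then obtain M where M: "\<And>m n. m \<ge> M \<Longrightarrow> n \<ge> M \<Longrightarrow> norm (a m - a n) < e\<^sup>2"
      using CauchyD[OF a, of "e\<^sup>2"] by auto
    have "dist (psum Z1 Z2 m h) (psum Z1 Z2 n h) < e" if "m \<ge> M" "n > m" for m n
    proof -
      have "(norm (psum Z1 Z2 n h - psum Z1 Z2 m h))\<^sup>2 \<le> a m - a n"
        using psum_diff[of m "n - m" h] that by (simp add: a_def)
      also have "\<dots> < e\<^sup>2" using M[of m n] that by simp
      finally show ?thesis
        using e by (simp add: dist_norm norm_minus_commute power_less_imp_less_base)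
    qed
    then show "\<exists>M. \<forall>m\<ge>M. \<forall>n>m. dist (psum Z1 Z2 m h) (psum Z1 Z2 n h) < e" by blast
  qed
  then show ?thesis by (rule Cauchy_convergent)
qed

lemma solution_exists:
  "\<exists>G. contraction G \<and> (\<forall>h. adj J (G h) = 0) \<and> (\<forall>h. G h = E (Z1 h) + U' (G (Z2 h)))"
proof -
  define G where "G h = lim (\<lambda>n. psum Z1 Z2 n h)" for h
  have G: "(\<lambda>n. psum Z1 Z2 n h) \<longlonglongrightarrow> G h" for h
    unfolding G_def using psum_convergent convergent_LIMSEQ_iff by blast
  have "clinear G"
  proof (rule clinearI)
    fix x y a
    have "(\<lambda>n. psum Z1 Z2 n (x + y)) \<longlonglongrightarrow> G x + G y"
      using tendsto_add[OF G[of x] G[of y]] by (simp add: bop_simps[OF psum_bop])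
    then show "G (x + y) = G x + G y" by (rule LIMSEQ_unique[OF G])
    have "(\<lambda>n. psum Z1 Z2 n (scaleC a x)) \<longlonglongrightarrow> scaleC a (G x)"
      using bop_tendsto[OF bop_scaleC G[of x]] by (simp add: bop_simps[OF psum_bop])
    then show "G (scaleC a x) = scaleC a (G x)" by (rule LIMSEQ_unique[OF G])
  qed
  moreover have "norm (G h) \<le> norm h" for h
  proof (rule LIMSEQ_le_const2[OF tendsto_norm[OF G]])
    have "norm (psum Z1 Z2 n h) \<le> norm h" for n
    proof (rule power2_le_imp_le)
      show "(norm (psum Z1 Z2 n h))\<^sup>2 \<le> (norm h)\<^sup>2"
        using psum_norm[of n h] zero_le_power2[of "norm ((Z2 ^^ n) h)"] by linarith
    qed simp
    then show "\<exists>N. \<forall>n\<ge>N. norm (psum Z1 Z2 n h) \<le> norm h" by blast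
  qed
  moreover have "adj J (G h) = 0" for h
    using LIMSEQ_unique[OF bop_tendsto[OF bop_adj[OF bops(3)] G[of h]]] by (simp add: adj_J_psum)
  moreover have "G h = E (Z1 h) + U' (G (Z2 h))" for h
  proof (rule LIMSEQ_unique)
    show "(\<lambda>n. psum Z1 Z2 (Suc n) h) \<longlonglongrightarrow> G h"
      using G[of h] by (rule LIMSEQ_Suc)
    show "(\<lambda>n. psum Z1 Z2 (Suc n) h) \<longlonglongrightarrow> E (Z1 h) + U' (G (Z2 h))"
      unfolding psum.simps by (intro tendsto_add tendsto_const bop_tendsto[OF bops(4)] G)
  qed
  ultimately show ?thesis unfolding contraction_def by blast
qed

text \<open>Agreement with \<omega> on F is what yields \<open>U' B R = B Q\<close>; the behaviour
  off F remains free, and this freedom is the source of non-uniqueness.\<close>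

lemma interpolant_exists:
  assumes ext: "\<And>f. f \<in> F \<Longrightarrow> Z1 f = w1 f" "\<And>f. f \<in> F \<Longrightarrow> Z2 f = w2 f"
  shows "\<exists>B G. contractive_interpolant A J U' R Q B \<and> represents G B \<and>
    (\<forall>n h. adj (wander n) (G h) = Z1 ((Z2 ^^ n) h))"
proof -
  obtain G where Gc: "contraction G" and JG: "\<And>h. adj J (G h) = 0"
      and rec: "\<And>h. G h = E (Z1 h) + U' (G (Z2 h))"
    using solution_exists by blast
  define B where "B h = J (A h) + G (defect A h)" for h
  have Gb: "bop G" by (rule contraction_bop[OF Gc])
  have "bop B"
    unfolding B_def by (rule bop_add[OF bop_compose[OF bops(3,1)] bop_compose[OF Gb defect_bop[OF A]]])
  moreover have "norm (B h) \<le> norm h" for h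
  proof (rule power2_le_imp_le)
    have "(norm (B h))\<^sup>2 = (norm (A h))\<^sup>2 + (norm (G (defect A h)))\<^sup>2"
      using J by (simp add: B_def pythagoras cinner_adj[OF bops(3)] JG isometry_def)
    also have "\<dots> \<le> (norm (A h))\<^sup>2 + (norm (defect A h))\<^sup>2"
      using Gc by (simp add: contraction_def power_mono)
    finally show "(norm (B h))\<^sup>2 \<le> (norm h)\<^sup>2" by (simp add: norm_defect_sq[OF A])
  qed simp
  moreover have "adj J (B h) = A h" for h
    by (simp add: B_def bop_simps[OF bop_adj[OF bops(3)]] adj_J_J JG)
  moreover have "U' (B (R x)) = B (Q x)" for x
  proof -
    have "G (defect A (Q x)) = U' (J (A (R x))) - J (A (Q x)) + U' (G (defect A (R x)))"
      by (subst rec) (simp add: ext[OF in_F] w1_defect w2_defect E_defect intertwine)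
    then show ?thesis by (simp add: B_def bop_simps[OF bops(4)])
  qed
  ultimately have "contractive_interpolant A J U' R Q B"
    by (simp add: contractive_interpolant_def contraction_def bop_clinear)
  moreover have "represents G B" by (simp add: represents_def Gc JG B_def)
  moreover have "adj (wander n) (G h) = Z1 ((Z2 ^^ n) h)" for n h
  proof (induction n arbitrary: h)
    case 0
    then show ?case using adj_wander_step(1)[OF Z(3) JG] rec[of h] by simp
  next
    case (Suc n)
    then show ?case
      using adj_wander_step(2)[OF Z(3) JG] rec[of h] by (simp only: funpow_Suc_right comp_def)
  qed
  ultimately show ?thesis by blast
qed

end

section \<open>The uniqueness criterion\<close>

text \<open>As \<open>w2\<close> vanishes off F, plain powers of \<open>w2\<close> can replace
  powers of its compression to F.\<close>

definition M :: "nat \<Rightarrow> 'h \<Rightarrow> 'g" where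
  "M n h = w1 ((w2 ^^ n) h)"

lemma M_0: "M 0 h = w1 h" and M_Suc: "M (Suc n) h = M n (w2 h)"
  by (simp_all add: M_def funpow_swap1)

lemma M_bop: "bop (M n)"
  unfolding M_def by (rule bop_compose[OF w1_bop bop_funpow[OF w2_bop]])

lemma M_proj: "M n h = M n (proj F h)"
proof (cases n)
  case 0
  then show ?thesis by (simp add: M_0 w1_proj[of h, symmetric])
next
  case (Suc m)
  then show ?thesis by (simp add: M_Suc w2_proj[of h, symmetric])
qed

lemma M_in_DT: "M n h \<in> DT"
  by (simp add: M_def w1_in_DT)

lemma coisometry_iff:
  "coisometry_on F DT (\<lambda>h. w1 (((\<lambda>x. proj F (w2 x)) ^^ n) h)) \<longleftrightarrow> (\<forall>y\<in>DT. M n (adj (M n) y) = y)"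
proof -
  \<comment> \<open>The two iterates themselves may differ, but only orthogonally to F, where
    \<open>w1\<close> and \<open>w2\<close> vanish.\<close>
  have *: "proj F (((\<lambda>x. proj F (w2 x)) ^^ n) h) = proj F ((w2 ^^ n) h)" for h
  proof (induction n)
    case (Suc n)
    have "w2 (((\<lambda>x. proj F (w2 x)) ^^ n) h) = w2 ((w2 ^^ n) h)"
      by (subst (1 2) w2_proj) (simp only: Suc)
    then show ?case by (simp add: proj_idem[OF F_space])
  qed simp
  have "w1 (((\<lambda>x. proj F (w2 x)) ^^ n) h) = M n h" for h
    unfolding M_def by (subst (1 2) w1_proj) (simp only: *)
  moreover have "(\<lambda>x. M n (proj F x)) = M n" by (rule ext) (rule M_proj[symmetric])
  ultimately show ?thesis
    using M_in_DT by (auto simp: coisometry_on_def)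
qed

section \<open>Either condition determines all coefficients\<close>

lemma coefficients_on_F:
  assumes B: "contractive_interpolant A J U' R Q B" and G: "represents G B" and f: "f \<in> F"
  shows "adj (wander 0) (G f) = M 0 f"
    and "adj (wander (Suc n)) (G f) = adj (wander n) (G (w2 f))"
proof -
  have k: "adj J (G (w2 f)) = 0" using G by (simp add: represents_def)
  show "adj (wander 0) (G f) = M 0 f"
    by (simp only: represented_recursion[OF B G f] adj_wander_step(1)[OF w1_in_DT k] M_0)
  show "adj (wander (Suc n)) (G f) = adj (wander n) (G (w2 f))"
    by (simp only: represented_recursion[OF B G f] adj_wander_step(2)[OF w1_in_DT k])
qed

lemma coefficient_contraction: "represents G B \<Longrightarrow> contraction (\<lambda>h. adj (wander n) (G h))"
  unfolding contraction_def
proof (intro conjI allI)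
  assume G: "represents G B"
  show "clinear (\<lambda>h. adj (wander n) (G h))"
    by (rule bop_clinear[OF bop_compose[OF bop_adj[OF wander_bop] represents_bop[OF G]]])
  show "norm (adj (wander n) (G h)) \<le> norm h" for h
    using contraction_adj_norm[OF wander_contraction, of n "G h"] G
    unfolding represents_def contraction_def by (meson order_trans)
qed

lemma coefficients_determined:
  assumes B: "contractive_interpolant A J U' R Q B" and G: "represents G B"
    and cond: "F = DA \<or> (\<forall>n. \<forall>y\<in>DT. M n (adj (M n) y) = y)" and d: "d \<in> DA"
  shows "adj (wander n) (G d) = M n d"
  using cond
proof
  assume F: "F = DA"
  show ?thesis
    using d
  proof (induction n arbitrary: d)
    case 0
    then show ?case using coefficients_on_F(1)[OF B G] F by simp
  next
    case (Suc n)
    then show ?case using coefficients_on_F(2)[OF B G] F w2_in_DA by (simp add: M_Suc)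
  qed
next
  assume co: "\<forall>n. \<forall>y\<in>DT. M n (adj (M n) y) = y"
  \<comment> \<open>Passing from F to the whole space is essential: the recursion evaluates the
    previous coefficient at \<open>w2 f\<close>, which need not lie in F.\<close>
  have step: "adj (wander n) (G h) = M n h" if "\<And>f. f \<in> F \<Longrightarrow> adj (wander n) (G f) = M n f" for n h
    by (rule contraction_extending_coisometry[OF F_space coefficient_contraction[OF G]
        adj_wander_in_DT M_bop M_proj]) (use co that in blast)+
  have "adj (wander n) (G h) = M n h" for h
  proof (induction n arbitrary: h)
    case 0
    show ?case by (rule step) (rule coefficients_on_F(1)[OF B G])
  next
    case (Suc n)
    show ?case
      by (rule step) (simp only: coefficients_on_F(2)[OF B G] Suc M_Suc)
  qed
  then show ?thesis .
qed

lemma represented_eq: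
  assumes G: "represents G B" "represents G' B'"
    and eq: "\<And>n d. d \<in> DA \<Longrightarrow> adj (wander n) (G d) = adj (wander n) (G' d)"
  shows "B = B'"
proof
  fix h
  let ?d = "defect A h"
  have "G ?d - G' ?d = 0"
  proof (rule orth_all_zero)
    show "adj J (G ?d - G' ?d) = 0"
      using G by (simp add: bop_simps[OF bop_adj[OF bops(3)]] represents_def)
    show "adj (wander n) (G ?d - G' ?d) = 0" for n
      using eq[OF defect_in_defect_space[OF A]] by (simp add: bop_simps[OF bop_adj[OF wander_bop]])
  qed
  then show "B h = B' h" using G by (simp add: represents_def)
qed

section \<open>Perturbation of the central interpolant\<close>

lemma central_exists:
  "\<exists>B G. contractive_interpolant A J U' R Q B \<and> represents G B \<and>
    (\<forall>n h. adj (wander n) (G h) = M n h)"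
  using interpolant_exists[OF w1_bop w2_bop w1_in_DT omega_contraction] by (simp add: M_def)

text \<open>With \<open>v = (a, b)\<close> and \<open>u = \<omega>\<^sup>* v\<close>, the map \<open>h \<mapsto> \<omega> \<Pi>\<^sub>\<F> h + \<langle>g, h\<rangle> (v - \<omega> \<omega>\<^sup>* v)\<close> is
  again contractive for small \<open>g \<bottom> \<F>\<close>: it equals \<open>\<omega> e + t v\<close> with \<open>t = \<langle>g, h\<rangle>\<close> and
  \<open>e = \<Pi>\<^sub>\<F> h - t u\<close>, and \<open>\<langle>\<omega> e, t v\<rangle> = \<langle>e, t u\<rangle>\<close>.\<close>

lemma perturbation_contraction:
  fixes a :: 'g and b g :: 'h
  defines "u \<equiv> adj w1 a + adj w2 b"
  assumes g: "\<And>f. f \<in> F \<Longrightarrow> cinner g f = 0"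
    and small: "(norm g)\<^sup>2 * ((norm a)\<^sup>2 + (norm b)\<^sup>2) \<le> 1"
  shows "(norm (w1 h + scaleC (cinner g h) (a - w1 u)))\<^sup>2
    + (norm (w2 h + scaleC (cinner g h) (b - w2 u)))\<^sup>2 \<le> (norm h)\<^sup>2"
proof -
  define f where "f = proj F h"
  define t where "t = cinner g h"
  define e where "e = f - scaleC t u"
  have 1: "w1 h + scaleC t (a - w1 u) = w1 e + scaleC t a"
    using w1_proj[of h] by (simp add: e_def f_def bop_simps[OF w1_bop] scaleC_diff_right)
  have 2: "w2 h + scaleC t (b - w2 u) = w2 e + scaleC t b"
    using w2_proj[of h] by (simp add: e_def f_def bop_simps[OF w2_bop] scaleC_diff_right)
  have cross: "Re (cinner (w1 e) (scaleC t a)) + Re (cinner (w2 e) (scaleC t b))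
      = Re (cinner e (scaleC t u))"
    by (simp add: cinner_scaleC_right cinner_adj[OF w1_bop] cinner_adj[OF w2_bop] u_def
        cinner_add_right algebra_simps)
  have f: "(norm f)\<^sup>2 = (norm e)\<^sup>2 + (norm (scaleC t u))\<^sup>2 + 2 * Re (cinner e (scaleC t u))"
    using norm_add_sq[of e "scaleC t u"] by (simp add: e_def)
  \<comment> \<open>\<open>t\<close> sees only \<open>h - f\<close>, so its size is paid for by the
    part of \<open>(norm h)^2\<close> that \<omega> does not use.\<close>
  have "cinner g h = cinner g (h - f)"
    using g[OF proj_in[OF F_space]] by (simp add: cinner_diff_right f_def)
  then have "cmod t \<le> norm g * norm (h - f)"
    using cinner_cauchy_schwarz[of g "h - f"] by (simp add: t_def)
  then have "(cmod t)\<^sup>2 \<le> (norm g)\<^sup>2 * (norm (h - f))\<^sup>2"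
    using power_mono[of "cmod t" "norm g * norm (h - f)" 2] by (simp add: power_mult_distrib)
  then have "(cmod t)\<^sup>2 * ((norm a)\<^sup>2 + (norm b)\<^sup>2)
      \<le> (norm g)\<^sup>2 * (norm (h - f))\<^sup>2 * ((norm a)\<^sup>2 + (norm b)\<^sup>2)"
    by (rule mult_right_mono) simp
  also have "\<dots> = ((norm g)\<^sup>2 * ((norm a)\<^sup>2 + (norm b)\<^sup>2)) * (norm (h - f))\<^sup>2" by simp
  also have "\<dots> \<le> 1 * (norm (h - f))\<^sup>2" by (rule mult_right_mono[OF small]) simp
  finally have t: "(cmod t)\<^sup>2 * ((norm a)\<^sup>2 + (norm b)\<^sup>2) \<le> (norm (h - f))\<^sup>2" by simp
  have "(norm (w1 e + scaleC t a))\<^sup>2 + (norm (w2 e + scaleC t b))\<^sup>2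
      = (norm (w1 e))\<^sup>2 + (norm (w2 e))\<^sup>2 + (cmod t)\<^sup>2 * ((norm a)\<^sup>2 + (norm b)\<^sup>2)
        + 2 * Re (cinner e (scaleC t u))"
    unfolding cross[symmetric]
    by (simp add: norm_add_sq norm_scaleC power_mult_distrib distrib_left)
  also have "\<dots> \<le> (norm e)\<^sup>2 + (norm (h - f))\<^sup>2 + 2 * Re (cinner e (scaleC t u))"
    using omega_contraction[of e] t by linarith
  also have "\<dots> \<le> (norm f)\<^sup>2 + (norm (h - f))\<^sup>2"
    using f zero_le_power2[of "norm (scaleC t u)"] by linarith
  also have "\<dots> = (norm h)\<^sup>2"
    using proj_norm_sq[OF F_space, of h] by (simp add: f_def)
  finally show ?thesis by (simp only: t_def[symmetric] 1 2)
qed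

text \<open>Coefficients of the central and the perturbed interpolant are compared at
  \<open>g\<close>, where the central ones vanish and the perturbed pair takes the value
  \<open>cinner g g\<close> times \<open>(a - w1 u, b - w2 u)\<close>.\<close>

lemma unique_imp_fixed:
  assumes uniq: "\<exists>!B. contractive_interpolant A J U' R Q B" and F: "F \<noteq> DA"
    and a: "a \<in> DT" and b: "b \<in> DA"
  defines "u \<equiv> adj w1 a + adj w2 b"
  shows "w1 u = a" and "M n b = M n (w2 u)"
proof -
  obtain d where d: "d \<in> DA" "d \<notin> F" using F F_subset_DA by blast
  define g0 where "g0 = d - proj F d"
  have g0: "g0 \<noteq> 0" using d(2) proj_in[OF F_space, of d] by (auto simp: g0_def)
  have g0_DA: "g0 \<in> DA"
    unfolding g0_def
    by (rule csubspace_diff[OF DA_space(1) d(1)]) (use F_subset_DA proj_in[OF F_space] in blast)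
  \<comment> \<open>Normalized to \<open>norm g = 1 / (s + 1)\<close> with
    \<open>s = (norm a)^2 + (norm b)^2\<close>, so smallness becomes
    \<open>s \<le> (s + 1)^2\<close>.\<close>
  define r where "r = 1 / (norm g0 * ((norm a)\<^sup>2 + (norm b)\<^sup>2 + 1))"
  define g where "g = r *\<^sub>R g0"
  have r: "r > 0"
    using g0 by (simp add: r_def add_nonneg_pos)
  have g_DA: "g \<in> DA" unfolding g_def by (rule csubspace_scaleR[OF DA_space(1) g0_DA])
  have gF: "cinner g f = 0" if "f \<in> F" for f
    using proj_orth[OF F_space that] by (simp add: g_def g0_def cinner_scaleR_left)
  have small: "(norm g)\<^sup>2 * ((norm a)\<^sup>2 + (norm b)\<^sup>2) \<le> 1"
  proof -
    define s where "s = (norm a)\<^sup>2 + (norm b)\<^sup>2"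
    have s: "0 \<le> s" by (simp add: s_def)
    have "norm g = 1 / (s + 1)" using r g0 s by (simp add: g_def r_def s_def)
    moreover have "s \<le> (s + 1)\<^sup>2" using s by (simp add: power2_eq_square algebra_simps)
    ultimately show ?thesis
      unfolding s_def[symmetric] using s by (simp add: power_divide divide_le_eq)
  qed
  let ?p = "a - w1 u" and ?q = "b - w2 u"
  let ?Z1 = "\<lambda>h. w1 h + scaleC (cinner g h) ?p" and ?Z2 = "\<lambda>h. w2 h + scaleC (cinner g h) ?q"
  have p: "?p \<in> DT" by (rule csubspace_diff[OF DT_space(1) a w1_in_DT])
  have q: "?q \<in> DA" by (rule csubspace_diff[OF DA_space(1) b w2_in_DA])
  have "?Z1 h \<in> DT" for h
    using DT_space(1) w1_in_DT p by (simp add: csubspace_def)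
  from interpolant_exists[OF bop_add[OF w1_bop bop_cinner_scaleC] bop_add[OF w2_bop bop_cinner_scaleC]
      this perturbation_contraction[OF gF small, folded u_def]]
  obtain B1 G1 where B1: "contractive_interpolant A J U' R Q B1" "represents G1 B1"
      and G1: "\<And>n h. adj (wander n) (G1 h) = ?Z1 ((?Z2 ^^ n) h)"
    by (auto simp: gF)
  obtain B0 G0 where B0: "contractive_interpolant A J U' R Q B0" "represents G0 B0"
      and G0: "\<And>n h. adj (wander n) (G0 h) = M n h"
    using central_exists by blast
  have "B0 = B1" using uniq B0(1) B1(1) by blast
  \<comment> \<open>Equal interpolants identify their representatives only on the closed range of
    \<open>defect A\<close>, which is why \<open>g\<close> and later \<open>?Z2 g\<close> must be
    shown to lie there.\<close>
  have "G0 h = G1 h" if "h \<in> DA" for h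
  proof (rule bop_eq_on_closure[OF represents_bop[OF B0(2)] represents_bop[OF B1(2)]])
    show "h \<in> closure (range (defect A))" using that by (simp add: defect_space_def)
    fix x assume "x \<in> range (defect A)"
    then show "G0 x = G1 x"
      using B0(2) B1(2) \<open>B0 = B1\<close> unfolding represents_def by (metis add_left_cancel rangeE)
  qed
  then have coeff: "?Z1 ((?Z2 ^^ n) h) = M n h" if "h \<in> DA" for n h
    using G0 G1 that by metis
  have Pg: "proj F g = 0"
    by (rule proj_unique[OF F_space(1)]) (use F_space gF in \<open>auto simp: csubspace_def\<close>)
  have Mg: "M n g = 0" for n
    using M_proj[of n g] by (simp add: Pg bop_simps[OF M_bop])
  have w2g: "w2 g = 0" using w2_proj[of g] by (simp add: Pg bop_simps[OF w2_bop])
  have gg: "cinner g g \<noteq> 0" using r g0 by (simp add: cinner_eq_zero_iff g_def)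
  have cancel: "x = 0" if "scaleC (cinner g g) x = 0" for x :: "'b::complex_inner"
    using that gg by (metis norm_scaleC norm_eq_zero mult_eq_0_iff)
  have "scaleC (cinner g g) ?p = 0"
    using coeff[OF g_DA, of 0] Mg[of 0] by (simp add: M_0)
  then show "w1 u = a" using cancel by fastforce
  have Z2g: "?Z2 g = scaleC (cinner g g) ?q" by (simp add: w2g)
  have "?Z2 g \<in> DA" unfolding Z2g using DA_space(1) q by (simp add: csubspace_def)
  \<comment> \<open>Coefficient n at \<open>?Z2 g\<close> is coefficient n + 1 at \<open>g\<close>,
    and that one is zero.\<close>
  then have "M n (?Z2 g) = ?Z1 ((?Z2 ^^ n) (?Z2 g))" by (rule coeff[symmetric])
  also have "\<dots> = ?Z1 ((?Z2 ^^ Suc n) g)" by (simp only: funpow_Suc_right comp_def)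
  also have "\<dots> = 0" using coeff[OF g_DA, of "Suc n"] Mg[of "Suc n"] by (simp only:)
  finally have "scaleC (cinner g g) (M n ?q) = 0"
    unfolding Z2g by (simp only: bop_simps[OF M_bop])
  then have "M n ?q = 0" by (rule cancel)
  then show "M n b = M n (w2 u)" by (simp add: bop_simps[OF M_bop])
qed

lemma unique_imp_coisometries:
  assumes uniq: "\<exists>!B. contractive_interpolant A J U' R Q B" and F: "F \<noteq> DA" and y: "y \<in> DT"
  shows "M n (adj (M n) y) = y"
proof (induction n)
  case 0
  have "0 \<in> DA" using DA_space(1) by (simp add: csubspace_def)
  moreover have "M 0 = w1" by (rule ext) (rule M_0)
  ultimately show ?case
    using unique_imp_fixed(1)[OF uniq F y, of 0] by (simp add: bop_simps[OF bop_adj[OF w2_bop]])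
next
  case (Suc n)
  define x where "x = adj (M n) y"
  have "x \<in> F" unfolding x_def by (rule adj_in_subspace[OF F_space M_bop M_proj])
  then have x: "x \<in> DA" using F_subset_DA by blast
  have 0: "0 \<in> DT" using DT_space(1) by (simp add: csubspace_def)
  have "M n x = M n (w2 (adj w2 x))"
    using unique_imp_fixed(2)[OF uniq F 0 x, of n] by (simp add: bop_simps[OF bop_adj[OF w1_bop]])
  \<comment> \<open>This explains the choice of \<open>x\<close>: \<open>M (Suc n)\<close> at this
    vector is \<open>M n (w2 (adj w2 x))\<close>, just shown to equal \<open>M n x\<close>, which is
    \<open>y\<close> by induction.\<close>
  moreover have "adj (M (Suc n)) y = adj w2 x"
    by (rule cinner_right_cancel)
      (simp add: cinner_adj[OF M_bop, symmetric] cinner_adj[OF w2_bop, symmetric] x_def M_Suc)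
  ultimately show ?case
    using Suc M_Suc[of n "adj (M (Suc n)) y"] by (simp only: x_def)
qed

lemma unique_iff:
  "(\<exists>!B. contractive_interpolant A J U' R Q B) \<longleftrightarrow>
    F = DA \<or> (\<forall>n. \<forall>y\<in>DT. M n (adj (M n) y) = y)" (is "_ \<longleftrightarrow> ?cond")
proof
  assume cond: ?cond
  obtain B where B: "contractive_interpolant A J U' R Q B" using central_exists by blast
  show "\<exists>!B. contractive_interpolant A J U' R Q B"
  proof (rule ex1I[of _ B], rule B)
    fix B' assume B': "contractive_interpolant A J U' R Q B'"
    obtain G G' where G: "represents G B" and G': "represents G' B'"
      using interpolant_represented B B' by blast
    show "B' = B"
      by (rule represented_eq[OF G' G])
        (simp add: coefficients_determined[OF B G cond] coefficients_determined[OF B' G' cond])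
  qed
qed (use unique_imp_coisometries in blast)

end

theorem theorem0p1:
  fixes A :: "'h::chilbert \<Rightarrow> 'g::chilbert" and T' :: "'g \<Rightarrow> 'g"
    and J :: "'g \<Rightarrow> 'k::chilbert" and U' :: "'k \<Rightarrow> 'k"
    and R Q :: "'z::chilbert \<Rightarrow> 'h"
  assumes "data_set A T' J U' R Q"
  shows "(\<exists>!B. contractive_interpolant A J U' R Q B) \<longleftrightarrow>
           (F_space A Q = defect_space A \<or>
            (\<forall>n::nat. coisometry_on (F_space A Q) (defect_space T')
                (\<lambda>h. omega1 A T' R Q (((\<lambda>x. proj (F_space A Q) (omega2 A R Q x)) ^^ n) h))))"
proof -
  interpret relaxed_lifting A T' J U' R Q by unfold_locales (rule assms)
  show ?thesis unfolding unique_iff coisometry_iff ..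
qed

end
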